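(* There are at least $60$ pairwise inequivalent self-dual $\mathbb{Z}_4$-codes of length $24$ and minimum Lee weight $10$.
   Context: A $\mathbb{Z}_4$-code of length $n$ is a $\mathbb{Z}_4$-submodule $\mathcal{C}$ of $\mathbb{Z}_4^n$, where $\mathbb{Z}_4=\{0,1,2,3\}$ is the ring of integers modulo $4$. Its dual is $\mathcal{C}^\perp=\{x\in\mathbb{Z}_4^n \mid x\cdot y=0 \text{ for all } y\in\mathcal{C}\}$, with $x\cdot y$ the standard inner product; $\mathcal{C}$ is self-dual if $\mathcal{C}=\mathcal{C}^\perp$. Two $\mathbb{Z}_4$-codes are equivalent if one can be obtained from the other by permuting the coordinates and (if necessary) changing the signs of certain coordinates. For $x\in\mathbb{Z}_4^n$ let $n_i(x)$ be the number of components of $x$ equal to $i$. The Lee weight of $x$ is $n_1(x)+2n_2(x)+n_3(x)$, and the minimum Lee weight of $\mathcal{C}$ is the smallest Lee weight among all non-zero codewords of $\mathcal{C}$. *)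

theory Defs
  imports "HOL-Analysis.Finite_Cartesian_Product"
begin

text \<open>
  The ring of integers modulo 4 is the numeral type \<^typ>\<open>4\<close>, whose arithmetic is modulo 4.
  A word of length \<open>n\<close> is a vector over it with an index type of cardinality \<open>n\<close>, so that
  length 24 is the vector type \<open>4 ^ 24\<close>.
\<close>

type_synonym Z4 = 4

lemma module_vec: "module ((*s) :: 'a \<Rightarrow> 'a ^ 'n \<Rightarrow> 'a::comm_ring_1 ^ 'n)"
  by unfold_locales (simp_all add: vec_eq_iff algebra_simps)

definition Z4_code :: "(Z4 ^ 'n) set \<Rightarrow> bool" where
  "Z4_code C \<longleftrightarrow> module.subspace (*s) C"

definition dual_code :: "(Z4 ^ 'n) set \<Rightarrow> (Z4 ^ 'n) set" where
  "dual_code C = {x. \<forall>y\<in>C. scalar_product x y = 0}"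

definition self_dual :: "(Z4 ^ 'n) set \<Rightarrow> bool" where
  "self_dual C \<longleftrightarrow> C = dual_code C"

definition equivalent_codes :: "(Z4 ^ 'n) set \<Rightarrow> (Z4 ^ 'n) set \<Rightarrow> bool" where
  "equivalent_codes C D \<longleftrightarrow>
    (\<exists>\<pi> \<epsilon>. bij \<pi> \<and> (\<forall>i. \<epsilon> i \<in> {1, -1}) \<and> D = (\<lambda>x. \<chi> i. \<epsilon> i * x $ \<pi> i) ` C)"

definition num_comp :: "Z4 \<Rightarrow> Z4 ^ 'n \<Rightarrow> nat" where
  "num_comp a x = card {i. x $ i = a}"

definition lee_weight :: "Z4 ^ 'n \<Rightarrow> nat" where
  "lee_weight x = num_comp 1 x + 2 * num_comp 2 x + num_comp 3 x"

text \<open>Unspecified for the zero code, which has no non-zero codewords.\<close>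

definition min_lee_weight :: "(Z4 ^ 'n) set \<Rightarrow> nat" where
  "min_lee_weight C = Min (lee_weight ` (C - {0}))"

end

theory Submission
  imports Defs
begin

text \<open>
  Start from a self-dual code \<open>C\<close> whose residue code is the binary Golay code and whose Euclidean
  weights are divisible by 8; its minimum Lee weight is 12. For a set \<open>v\<close> of four coordinates the
  neighbour \<open>twisted v C\<close> is again self-dual. Words outside the common subcode have Euclidean weight
  4 modulo 8, and at least 8 odd entries, hence Lee weight at least 10; the value 10 occurs because
  the octads form a Steiner system S(5,8,24). The Euclidean weight modulo 8 is an invariant linear
  functional that recovers \<open>v\<close> modulo the Golay code, so that an equivalence between two neighbours
  comes from an automorphism of \<open>C\<close>. The 1771 sets \<open>v\<close> that contain a fixed coordinate \<open>z\<close> are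
  distinct modulo the Golay code, and \<open>C\<close> is chosen such that only the trivial automorphism fixes
  \<open>z\<close>. Hence at most 24 of the 1771 neighbours are equivalent to a given one, which leaves at least
  74 classes.

  To see that an automorphism fixing \<open>z\<close> is trivial, note that each octad that avoids \<open>z\<close> is the odd
  support of a codeword with exactly two entries 2, one of them at \<open>z\<close>; the position of the other one
  is determined by the octad. This divides the 506 octads into 23 lists of length 22, and a numerical
  invariant separates these lists.
\<close>

section \<open>Words and codes over the integers modulo 4\<close>

text \<open>The symmetry of C limits the number of classes, and this dictates the choice of C. The
  best known lift of the Golay code, the extended quadratic residue code, admits PSL(2,23) on its
  coordinates; that group has order 6072, more than the number of neighbours, so the count would
  give nothing. A less symmetric lift is needed. Rigidity at one coordinate bounds the group without
  determining it.

  The coordinate \<open>z\<close> has two further roles. Since all sets \<open>v\<close> contain it,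
  two of them differ in at most six places, fewer than the minimum weight 8 of the residue code. And
  a codeword of Lee weight 12 with a 2 at \<open>z\<close> can lose that 2 under twisting, which
  produces the weight 10.

  The octads are not found by running through the 4096 residue words. A packing bound gives at most
  759 = C(24,5)/C(8,5) of them, so 759 distinct listed octads are all octads, and lists of short
  messages suffice as a certificate.\<close>

lemma Z4_exhaust: "x = 0 \<or> x = 1 \<or> x = 2 \<or> x = (3::Z4)"
proof (cases x rule: bit0_cases)
  case (of_int z)
  then have "z \<in> {0,1,2,3}" by auto
  then show ?thesis using of_int(1) by auto
qed

lemma Z4_cases [case_names 0 1 2 3]:
  fixes x :: Z4
  obtains "x = 0" | "x = 1" | "x = 2" | "x = 3"
  using Z4_exhaust by blast

lemma Z4_four_mult [simp]: "4 * a = (0::Z4)"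
proof -
  have "(4::Z4) = 0" by simp
  then show ?thesis by (metis mult_zero_left)
qed

lemma of_nat_8_eq_0_iff: "(of_nat n :: 8) = 0 \<longleftrightarrow> 8 dvd n"
  by (simp add: of_nat_eq_0_iff_char_dvd)

lemma scalar_product_commute: "scalar_product x y = scalar_product y (x :: Z4 ^ 'n)"
  by (simp add: scalar_product_def mult.commute)

lemma scalar_product_add_left:
  "scalar_product (x + y) z = scalar_product x z + scalar_product y (z :: Z4 ^ 'n)"
  by (simp add: scalar_product_def algebra_simps sum.distrib)

lemma scalar_product_add_right:
  "scalar_product z (x + y) = scalar_product z x + scalar_product z (y :: Z4 ^ 'n)"
  by (simp add: scalar_product_def algebra_simps sum.distrib)

lemma scalar_product_scale_left: "scalar_product (c *s x) y = c * scalar_product x (y :: Z4 ^ 'n)"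
  by (simp add: scalar_product_def sum_distrib_left mult.assoc)

lemma scalar_product_scale_right: "scalar_product x (c *s y) = c * scalar_product x (y :: Z4 ^ 'n)"
  by (simp add: scalar_product_def sum_distrib_left mult.left_commute)

lemma scalar_product_zero_left [simp]: "scalar_product 0 (y :: Z4 ^ 'n) = 0"
  by (simp add: scalar_product_def)

lemmas scalar_product_simps = scalar_product_add_left scalar_product_add_right
  scalar_product_scale_left scalar_product_scale_right

lemma Z4_code_iff:
  "Z4_code C \<longleftrightarrow> 0 \<in> C \<and> (\<forall>x\<in>C. \<forall>y\<in>C. x + y \<in> C) \<and> (\<forall>c. \<forall>x\<in>C. c *s x \<in> C)"
proof -
  interpret module "(*s) :: Z4 \<Rightarrow> Z4 ^ 'n \<Rightarrow> Z4 ^ 'n" by (rule module_vec)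
  show ?thesis by (auto simp: Z4_code_def subspace_def)
qed

text \<open>Doubling identifies residues modulo 2 with words over 0 and 2. So this is the support of
  the residue word, and sums become symmetric differences.\<close>

definition odd_supp :: "Z4 ^ 'n \<Rightarrow> 'n set" where
  "odd_supp x = {i. 2 * x $ i \<noteq> 0}"

definition two_supp :: "Z4 ^ 'n \<Rightarrow> 'n set" where
  "two_supp x = {i. x $ i = 2}"

lemma Z4_double_neq_0_iff: "2 * x \<noteq> 0 \<longleftrightarrow> x = 1 \<or> x = (3::Z4)"
  by (cases x rule: Z4_cases) auto

lemma mem_odd_supp: "i \<in> odd_supp x \<longleftrightarrow> x $ i = 1 \<or> x $ i = 3"
  by (simp add: odd_supp_def Z4_double_neq_0_iff)

lemma mem_two_supp: "i \<in> two_supp x \<longleftrightarrow> x $ i = 2"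
  by (simp add: two_supp_def)

lemma odd_two_supp_disjoint: "odd_supp x \<inter> two_supp x = {}"
  by (auto simp: mem_odd_supp mem_two_supp)

lemma odd_two_supp_empty: "odd_supp x = {} \<Longrightarrow> two_supp x = {} \<Longrightarrow> x = 0"
  unfolding vec_eq_iff set_eq_iff mem_odd_supp mem_two_supp empty_iff zero_index
  using Z4_exhaust by metis

lemma odd_supp_add: "odd_supp (x + y) = sym_diff (odd_supp x) (odd_supp y)"
proof -
  have "2 * (a + b) \<noteq> 0 \<longleftrightarrow> (2 * a \<noteq> 0) \<noteq> (2 * b \<noteq> 0)" for a b :: Z4
    by (cases a rule: Z4_cases; cases b rule: Z4_cases) simp_all
  then show ?thesis by (auto simp: odd_supp_def)
qed

lemma odd_supp_diff: "odd_supp (x - y) = sym_diff (odd_supp x) (odd_supp y)"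
proof -
  have "2 * (a - b) \<noteq> 0 \<longleftrightarrow> (2 * a \<noteq> 0) \<noteq> (2 * b \<noteq> 0)" for a b :: Z4
    by (cases a rule: Z4_cases; cases b rule: Z4_cases) simp_all
  then show ?thesis by (auto simp: odd_supp_def)
qed

lemma odd_supp_double [simp]: "odd_supp (2 *s x) = {}"
proof -
  have "2 * (2 * a) = 0" for a :: Z4
    by (cases a rule: Z4_cases) simp_all
  then show ?thesis by (simp add: odd_supp_def)
qed

lemma odd_supp_zero [simp]: "odd_supp 0 = {}"
  by (simp add: odd_supp_def)

lemma two_supp_double: "two_supp (2 *s x) = odd_supp x"
proof -
  have "2 * a = 2 \<longleftrightarrow> 2 * a \<noteq> 0" for a :: Z4
    by (cases a rule: Z4_cases) simp_all
  then show ?thesis by (simp add: odd_supp_def two_supp_def)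
qed

lemma lee_weight_eq: "lee_weight x = card (odd_supp x) + 2 * card (two_supp x)"
proof -
  have "odd_supp x = {i. x $ i = 1} \<union> {i. x $ i = 3}"
    by (auto simp: mem_odd_supp)
  moreover have "{i. x $ i = 1} \<inter> {i. x $ i = 3} = {}"
    by auto
  ultimately have "card (odd_supp x) = card {i. x $ i = 1} + card {i. x $ i = 3}"
    by (simp add: card_Un_disjoint)
  then show ?thesis
    by (simp add: lee_weight_def num_comp_def two_supp_def)
qed

text \<open>The square of a residue modulo 4 and its double are well defined modulo 8.\<close>

definition sq8 :: "Z4 \<Rightarrow> 8" where
  "sq8 a = (if a = 0 then 0 else if a = 2 then 4 else 1)"

definition dbl8 :: "Z4 \<Rightarrow> 8" where
  "dbl8 a = (if a = 0 then 0 else if a = 1 then 2 else if a = 2 then 4 else 6)"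

definition euclid8 :: "Z4 ^ 'n \<Rightarrow> 8" where
  "euclid8 x = (\<Sum>i\<in>UNIV. sq8 (x $ i))"

lemma sq8_add: "sq8 (a + b) = sq8 a + sq8 b + dbl8 (a * b)"
  by (cases a rule: Z4_cases; cases b rule: Z4_cases) (simp_all add: sq8_def dbl8_def)

lemma sq8_mult: "sq8 (a * b) = sq8 a * sq8 b"
  by (cases a rule: Z4_cases; cases b rule: Z4_cases) (simp_all add: sq8_def)

lemma dbl8_add: "dbl8 (a + b) = dbl8 a + dbl8 b"
  by (cases a rule: Z4_cases; cases b rule: Z4_cases) (simp_all add: dbl8_def)

lemma dbl8_sum: "dbl8 (sum f A) = (\<Sum>i\<in>A. dbl8 (f i))"
proof (induction A rule: infinite_finite_induct)
  case (insert i A)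
  then show ?case by (simp add: dbl8_add)
qed (simp_all add: dbl8_def)

text \<open>Polarisation: twice the inner product, read modulo 8, is the only cross term. Hence the
  Euclidean weight modulo 8 is additive on a self-orthogonal code.\<close>

lemma euclid8_add: "euclid8 (x + y) = euclid8 x + euclid8 y + dbl8 (scalar_product x y)"
  by (simp add: euclid8_def scalar_product_def dbl8_sum sq8_add sum.distrib)

lemma euclid8_scale: "euclid8 (c *s x) = sq8 c * euclid8 x"
  by (simp add: euclid8_def sq8_mult sum_distrib_left)

lemma euclid8_eq: "euclid8 x = of_nat (card (odd_supp x) + 4 * card (two_supp x))"
proof -
  have *: "sq8 a = of_bool (2 * a \<noteq> 0) + 4 * of_bool (a = 2)" for a
    by (cases a rule: Z4_cases) (simp_all add: sq8_def)
  have "euclid8 x = (\<Sum>i\<in>UNIV. of_bool (i \<in> odd_supp x)) + 4 * (\<Sum>i\<in>UNIV. of_bool (i \<in> two_supp x))"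
    unfolding euclid8_def * by (simp add: sum.distrib sum_distrib_left odd_supp_def two_supp_def)
  then show ?thesis by (simp add: of_bool_def sum.If_cases)
qed

definition ind :: "'n set \<Rightarrow> Z4 ^ 'n" where
  "ind v = (\<chi> i. of_bool (i \<in> v))"

lemma ind_nth [simp]: "ind v $ i = of_bool (i \<in> v)"
  by (simp add: ind_def)

lemma odd_supp_ind [simp]: "odd_supp (ind v) = v"
  by (auto simp: odd_supp_def)

lemma even_double_Z4: "2 * (of_nat n :: Z4) = of_bool (odd n) * 2"
proof -
  have "even n \<Longrightarrow> (2 * of_nat n :: Z4) = 0"
    by (elim evenE) simp
  moreover have "odd n \<Longrightarrow> (2 * of_nat n :: Z4) = 2"
    by (elim oddE) simp
  ultimately show ?thesis by simp
qed

text \<open>Doubling keeps only the parity of the inner product, and an entry counts towards that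
  parity exactly when it is odd and lies over \<open>v\<close>.\<close>

lemma double_scalar_product_ind:
  "2 * scalar_product x (ind v) = of_bool (odd (card (v \<inter> odd_supp x))) * 2"
proof -
  have *: "2 * (a * of_bool P) = 2 * of_bool (P \<and> 2 * a \<noteq> 0)" for a :: Z4 and P
    by (cases a rule: Z4_cases) simp_all
  have "2 * scalar_product x (ind v) = 2 * (\<Sum>i\<in>UNIV. of_bool (i \<in> v \<inter> odd_supp x))"
    unfolding scalar_product_def sum_distrib_left by (intro sum.cong) (simp_all add: * odd_supp_def)
  also have "(\<Sum>i\<in>UNIV. of_bool (i \<in> v \<inter> odd_supp x)) = (of_nat (card (v \<inter> odd_supp x)) :: Z4)"
    by (simp add: of_bool_def sum.If_cases Int_def)
  finally show ?thesis by (simp add: even_double_Z4)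
qed

text \<open>Twisting by \<open>v\<close> passes to a neighbour of the code: the words that are orthogonal to
  \<open>ind v\<close> modulo 2 are kept and the others are translated by \<open>2 *s ind v\<close>.\<close>

definition twist :: "'n set \<Rightarrow> Z4 ^ 'n \<Rightarrow> Z4 ^ 'n" where
  "twist v x = x + (2 * scalar_product x (ind v)) *s ind v"

text \<open>The defining formula yields linearity; supports and weights are read off from this form
  by cases.\<close>

lemma twist_eq: "twist v x = (if odd (card (v \<inter> odd_supp x)) then x + 2 *s ind v else x)"
  by (simp add: twist_def double_scalar_product_ind)

lemma odd_supp_twist [simp]: "odd_supp (twist v x) = odd_supp x"
  by (simp add: twist_eq odd_supp_add)

lemma twist_add: "twist v (x + y) = twist v x + twist v y"
  by (simp add: twist_def scalar_product_simps vec_eq_iff algebra_simps)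

lemma twist_scale: "twist v (c *s x) = c *s twist v x"
  by (simp add: twist_def scalar_product_simps vec_eq_iff algebra_simps)

lemma twist_zero [simp]: "twist v 0 = 0"
  by (simp add: twist_def)

lemma twist_twist [simp]: "twist v (twist v x) = x"
proof -
  have "x + 2 *s ind v + 2 *s ind v = x"
    by (simp add: vec_eq_iff)
  then show ?thesis
    by (simp add: twist_eq[of v "twist v x"]) (simp add: twist_eq)
qed

text \<open>Two equal cross terms \<open>2 * (p * q)\<close> and the term
  \<open>4 * (p * q * r)\<close> add up to multiples of 4. The twist is thus a linear isometric
  involution, which is why it preserves self-duality.\<close>

lemma scalar_product_twist: "scalar_product (twist v x) (twist v y) = scalar_product x y"
proof -
  define p q r where "p = scalar_product x (ind v)" and "q = scalar_product y (ind v)"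
    and "r = scalar_product (ind v) (ind v)"
  have "scalar_product (ind v) y = q"
    by (simp add: q_def scalar_product_commute)
  then have "scalar_product (twist v x) (twist v y) = scalar_product x y + 4 * (p * q) + 4 * (p * q * r)"
    by (simp only: twist_def scalar_product_simps p_def[symmetric] q_def[symmetric] r_def[symmetric])
      (simp add: algebra_simps)
  then show ?thesis by simp
qed

definition twisted :: "'n set \<Rightarrow> (Z4 ^ 'n) set \<Rightarrow> (Z4 ^ 'n) set" where
  "twisted v C = twist v ` C"

lemma mem_twisted_iff: "x \<in> twisted v C \<longleftrightarrow> twist v x \<in> C"
  unfolding twisted_def by (metis image_iff twist_twist)

lemma Z4_code_twisted: "Z4_code C \<Longrightarrow> Z4_code (twisted v C)"
  by (simp add: Z4_code_iff mem_twisted_iff twist_add twist_scale)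

lemma self_dual_twisted:
  assumes "self_dual C"
  shows "self_dual (twisted v C)"
proof -
  have "x \<in> twisted v C \<longleftrightarrow> x \<in> dual_code (twisted v C)" for x
  proof -
    have "x \<in> twisted v C \<longleftrightarrow> (\<forall>y\<in>C. scalar_product (twist v x) y = 0)"
      using assms by (auto simp: mem_twisted_iff self_dual_def dual_code_def)
    also have "\<dots> \<longleftrightarrow> (\<forall>y\<in>C. scalar_product x (twist v y) = 0)"
      by (metis scalar_product_twist twist_twist)
    also have "\<dots> \<longleftrightarrow> x \<in> dual_code (twisted v C)"
      by (simp add: dual_code_def twisted_def)
    finally show ?thesis .
  qed
  then show ?thesis by (auto simp: self_dual_def)
qed

section \<open>Monomial maps: coordinate permutations with signs\<close>

definition monomial :: "('n \<Rightarrow> 'n) \<Rightarrow> ('n \<Rightarrow> Z4) \<Rightarrow> Z4 ^ 'n \<Rightarrow> Z4 ^ 'n" where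
  "monomial \<pi> \<epsilon> x = (\<chi> i. \<epsilon> i * x $ \<pi> i)"

lemma monomial_nth [simp]: "monomial \<pi> \<epsilon> x $ i = \<epsilon> i * x $ \<pi> i"
  by (simp add: monomial_def)

lemma equivalent_codes_iff:
  "equivalent_codes C D \<longleftrightarrow>
    (\<exists>\<pi> \<epsilon>. bij \<pi> \<and> range \<epsilon> \<subseteq> {1, -1} \<and> D = monomial \<pi> \<epsilon> ` C)"
  by (simp add: equivalent_codes_def monomial_def image_subset_iff)

text \<open>Words are pulled back along the permutation, which reverses composition: the map applied
  last contributes the inner permutation.\<close>

lemma monomial_monomial:
  "monomial \<rho> \<delta> (monomial \<pi> \<epsilon> x) = monomial (\<pi> \<circ> \<rho>) (\<lambda>i. \<delta> i * \<epsilon> (\<rho> i)) x"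
  by (simp add: vec_eq_iff mult.assoc)

lemma sign_mult: "range \<epsilon> \<subseteq> {1, -1 :: Z4} \<Longrightarrow> range \<delta> \<subseteq> {1, -1} \<Longrightarrow> range (\<lambda>i. \<delta> i * \<epsilon> (f i)) \<subseteq> {1, -1}"
proof (rule image_subsetI)
  fix i
  assume "range \<epsilon> \<subseteq> {1, -1}" "range \<delta> \<subseteq> {1, -1}"
  then have "\<epsilon> (f i) \<in> {1, -1}" "\<delta> i \<in> {1, -1}" by blast+
  then show "\<delta> i * \<epsilon> (f i) \<in> {1, -1}" by auto
qed

lemma monomial_inv:
  assumes "bij \<pi>" "range \<epsilon> \<subseteq> {1, -1}"
  shows "monomial (inv \<pi>) (\<lambda>i. \<epsilon> (inv \<pi> i)) (monomial \<pi> \<epsilon> x) = x"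
proof -
  have "\<epsilon> i * \<epsilon> i = 1" for i
  proof -
    have "\<epsilon> i \<in> {1, -1}" using assms(2) by blast
    then show ?thesis by auto
  qed
  moreover have "\<pi> (inv \<pi> i) = i" for i
    using assms(1) by (simp add: bij_is_surj surj_f_inv_f)
  ultimately show ?thesis
    by (simp add: vec_eq_iff monomial_monomial mult.assoc[symmetric])
qed

lemma equivalent_codes_sym: "equivalent_codes C D \<Longrightarrow> equivalent_codes D C"
proof -
  assume "equivalent_codes C D"
  then obtain \<pi> \<epsilon> where *: "bij \<pi>" "range \<epsilon> \<subseteq> {1, -1}" "D = monomial \<pi> \<epsilon> ` C"
    unfolding equivalent_codes_iff by blast
  then have "C = monomial (inv \<pi>) (\<lambda>i. \<epsilon> (inv \<pi> i)) ` D"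
    unfolding *(3) image_image monomial_inv[OF *(1,2)] by simp
  moreover have "range (\<lambda>i. \<epsilon> (inv \<pi> i)) \<subseteq> {1, -1}"
    using *(2) by (simp add: image_subset_iff)
  ultimately show "equivalent_codes D C"
    unfolding equivalent_codes_iff using bij_imp_bij_inv[OF *(1)] by (intro exI conjI)
qed

lemma equivalent_codes_refl: "equivalent_codes C C"
proof -
  have "C = monomial id (\<lambda>_. 1) ` C"
    by (simp add: monomial_def)
  moreover have "range (\<lambda>_::'a. 1) \<subseteq> {1, -1::Z4}"
    by blast
  ultimately show ?thesis
    unfolding equivalent_codes_iff using bij_id by blast
qed

context
  fixes \<pi> :: "'n::finite \<Rightarrow> 'n" and \<epsilon> :: "'n \<Rightarrow> Z4"
  assumes bij: "bij \<pi>" and sign: "range \<epsilon> \<subseteq> {1, -1}"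
begin

lemma sign_cases: "\<epsilon> i = 1 \<or> \<epsilon> i = 3"
proof -
  have "\<epsilon> i \<in> {1, -1}" using sign by blast
  then show ?thesis by auto
qed

lemma sign_double: "\<epsilon> i * (2 * a) = 2 * a"
  using sign_cases[of i] by (cases a rule: Z4_cases) auto

lemma odd_supp_monomial: "odd_supp (monomial \<pi> \<epsilon> x) = \<pi> -` odd_supp x"
  unfolding odd_supp_def mult.left_commute[of 2] monomial_nth sign_double by blast

lemma two_supp_monomial: "two_supp (monomial \<pi> \<epsilon> x) = \<pi> -` two_supp x"
proof -
  have "\<epsilon> i * a = 2 \<longleftrightarrow> a = 2" for i a
    using sign_cases[of i] by (cases a rule: Z4_cases) auto
  then show ?thesis by (simp add: two_supp_def vimage_def)
qed

lemma card_vimage: "card (\<pi> -` A) = card A"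
  using bij by (simp add: card_vimage_inj bij_is_inj bij_is_surj)

lemma euclid8_monomial: "euclid8 (monomial \<pi> \<epsilon> x) = euclid8 x"
  by (simp add: euclid8_eq odd_supp_monomial two_supp_monomial card_vimage)

text \<open>A sign does not change an entry 2, so the added word \<open>2 *s ind w\<close> feels
  only the permutation; pulling words back along \<pi> turns \<open>w\<close> into its
  image.\<close>

lemma twist_monomial: "twist w (monomial \<pi> \<epsilon> x) = monomial \<pi> \<epsilon> (twist (\<pi> ` w) x)"
proof -
  have inj: "\<pi> i \<in> \<pi> ` w \<longleftrightarrow> i \<in> w" for i
    using bij by (simp add: bij_is_inj inj_image_mem_iff)
  have "w \<inter> odd_supp (monomial \<pi> \<epsilon> x) = \<pi> -` (\<pi> ` w \<inter> odd_supp x)"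
    using bij_is_inj[OF bij] by (auto simp: odd_supp_monomial dest: injD)
  then have "card (w \<inter> odd_supp (monomial \<pi> \<epsilon> x)) = card (\<pi> ` w \<inter> odd_supp x)"
    by (simp only: card_vimage)
  moreover have "monomial \<pi> \<epsilon> x + 2 *s ind w = monomial \<pi> \<epsilon> (x + 2 *s ind (\<pi> ` w))"
  proof -
    have "\<epsilon> i * x $ \<pi> i + 2 * of_bool (i \<in> w) = \<epsilon> i * (x $ \<pi> i + 2 * of_bool (\<pi> i \<in> \<pi> ` w))" for i
      unfolding distrib_left sign_double inj ..
    then show ?thesis
      by (simp only: vec_eq_iff vector_add_component vector_smult_component monomial_nth ind_nth) blast
  qed
  ultimately show ?thesis
    by (cases "odd (card (\<pi> ` w \<inter> odd_supp x))") (simp_all only: twist_eq if_True if_False simp_thms)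
qed

end

section \<open>Twisted codes and their equivalences\<close>

lemma card_sym_diff:
  assumes "finite A" "finite B"
  shows "card (sym_diff A B) + 2 * card (A \<inter> B) = card A + card B"
proof -
  have "card (sym_diff A B) = card (A - B) + card (B - A)"
    using assms by (intro card_Un_disjoint) auto
  moreover have "card A = card (A \<inter> B) + card (A - B)" "card B = card (A \<inter> B) + card (B - A)"
    using assms by (metis card_Int_Diff inf_commute)+
  ultimately show ?thesis by simp
qed

text \<open>\<open>halvable\<close> says that the torsion code equals the residue code, that is,
  that the code is free. The residue code is then a self-dual binary code, and
  \<open>residue_weight\<close> makes it the Golay code.\<close>

locale residue_code =
  fixes C :: "(Z4 ^ 24) set"
  assumes code: "Z4_code C"
    and dual: "self_dual C"
    and type_II: "x \<in> C \<Longrightarrow> euclid8 x = 0"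
    and halvable: "x \<in> C \<Longrightarrow> odd_supp x = {} \<Longrightarrow> \<exists>y\<in>C. x = 2 *s y"
    and residue_weight: "x \<in> C \<Longrightarrow> odd_supp x \<noteq> {} \<Longrightarrow> 8 \<le> card (odd_supp x)"
begin

lemma add_closed: "x \<in> C \<Longrightarrow> y \<in> C \<Longrightarrow> x + y \<in> C"
  and scale_closed: "x \<in> C \<Longrightarrow> c *s x \<in> C"
  using code by (auto simp: Z4_code_iff)

lemma diff_closed: "x \<in> C \<Longrightarrow> y \<in> C \<Longrightarrow> x - y \<in> C"
proof -
  assume "x \<in> C" "y \<in> C"
  then have "x + (-1) *s y \<in> C" by (intro add_closed scale_closed)
  moreover have "x + (-1) *s y = x - y" by (simp add: vec_eq_iff)
  ultimately show ?thesis by simp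
qed

text \<open>The difference of the words is \<open>2 *s u\<close>, and off the octad the odd support
  of \<open>u\<close> is the symmetric difference d of the two-supports. If that odd support has k
  points in the octad, then \<open>u\<close> and \<open>u + y\<close> have |d| + k and |d| + 8 - k
  odd entries, in total 2|d| + 8 < 16. For non-empty d both numbers would be at least 8.\<close>

lemma two_supp_determined:
  assumes "x \<in> C" "y \<in> C" "odd_supp x = odd_supp y" "card (odd_supp y) = 8"
    and "card (sym_diff (two_supp x) (two_supp y)) < 4"
  shows "two_supp x = two_supp y"
proof -
  let ?o = "odd_supp y" and ?d = "sym_diff (two_supp x) (two_supp y)"
  have "odd_supp (x - y) = {}"
    using assms(3) by (simp add: odd_supp_diff)
  then obtain u where u: "u \<in> C" "x - y = 2 *s u"
    using halvable diff_closed assms(1,2) by blast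
  have off: "i \<in> odd_supp u \<longleftrightarrow> i \<in> ?d" if "i \<notin> ?o" for i
  proof -
    have "i \<in> odd_supp u \<longleftrightarrow> x $ i - y $ i = 2"
      using u(2) by (metis mem_two_supp two_supp_double vector_minus_component)
    moreover have "x $ i \<noteq> 1" "x $ i \<noteq> 3" "y $ i \<noteq> 1" "y $ i \<noteq> 3"
      using that assms(3) mem_odd_supp by blast+
    ultimately show ?thesis
      by (cases "x $ i" rule: Z4_cases; cases "y $ i" rule: Z4_cases) (auto simp: mem_two_supp)
  qed
  have disj: "?d \<inter> ?o = {}"
    using odd_two_supp_disjoint[of x] odd_two_supp_disjoint[of y] assms(3) by blast
  define k where "k = card (odd_supp u \<inter> ?o)"
  have "odd_supp u = ?d \<union> (odd_supp u \<inter> ?o)"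
    using off disj by blast
  then have cu: "card (odd_supp u) = card ?d + k"
    unfolding k_def using disj by (metis card_Un_disjoint finite inf_commute inf_left_commute inf_bot_right)
  have "card (odd_supp (u + y)) + 2 * k = card (odd_supp u) + 8"
    unfolding odd_supp_add k_def using assms(4) by (simp only: card_sym_diff finite)
  then have cuy: "card (odd_supp (u + y)) + k = card ?d + 8"
    using cu by simp
  have "?d = {}"
  proof (rule ccontr)
    assume "?d \<noteq> {}"
    then obtain i where "i \<in> ?d" by blast
    then have "i \<in> odd_supp u" "i \<in> odd_supp (u + y)"
      using off disj unfolding odd_supp_add by blast+
    then have "8 \<le> card (odd_supp u)" "8 \<le> card (odd_supp (u + y))"
      using residue_weight u(1) assms(2) add_closed by blast+
    then show False using cu cuy assms(5) by simp
  qed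
  then show ?thesis by blast
qed

section \<open>The octads as a Steiner system S(5,8,24)\<close>

definition octads :: "24 set set" where
  "octads = {odd_supp x |x. x \<in> C \<and> card (odd_supp x) = 8}"

text \<open>Two sets of size 8 that share five points differ in at most six, fewer than the minimum
  weight of the residue code.\<close>

lemma octads_inter:
  assumes "a \<in> octads" "b \<in> octads" "5 \<le> card (a \<inter> b)"
  shows "a = b"
proof (rule ccontr)
  assume "a \<noteq> b"
  obtain x y where xy: "x \<in> C" "y \<in> C" "a = odd_supp x" "b = odd_supp y" "card a = 8" "card b = 8"
    using assms unfolding octads_def by blast
  then have "odd_supp (x + y) \<noteq> {}"
    using \<open>a \<noteq> b\<close> unfolding odd_supp_add by blast
  then have "8 \<le> card (sym_diff a b)"
    using residue_weight add_closed xy(1-4) unfolding odd_supp_add by (metis add_closed odd_supp_add)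
  then show False
    using card_sym_diff[of a b] xy(5,6) assms(3) by simp
qed

abbreviation quintuples :: "24 set \<Rightarrow> 24 set set" where
  "quintuples a \<equiv> {F. F \<subseteq> a \<and> card F = 5}"

lemma card_quintuples_octads: "card (\<Union>a\<in>octads. quintuples a) = 56 * card octads"
proof -
  have card_sub: "card (quintuples a) = 56" if "a \<in> octads" for a
  proof -
    have "card a = 8" using that by (auto simp: octads_def)
    then have "card (quintuples a) = 8 choose 5"
      using n_subsets[of a 5] by simp
    then show ?thesis by (simp add: numeral_eq_Suc)
  qed
  have "card (\<Union>a\<in>octads. quintuples a) = (\<Sum>a\<in>octads. card (quintuples a))"
  proof (intro card_UN_disjoint ballI impI)
    fix a b assume ab: "a \<in> octads" "b \<in> octads" "a \<noteq> b"
    show "quintuples a \<inter> quintuples b = {}"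
    proof (rule ccontr)
      assume "quintuples a \<inter> quintuples b \<noteq> {}"
      then obtain F where "F \<subseteq> a \<inter> b" "card F = 5" by blast
      then have "5 \<le> card (a \<inter> b)" by (metis card_mono finite)
      then show False using ab octads_inter by blast
    qed
  qed auto
  also have "\<dots> = 56 * card octads"
    using card_sub by simp
  finally show ?thesis .
qed

text \<open>C(24,5) = 42504 is factored so that the quotient by C(8,5) = 56 is visible: 759 is the
  size of a full Steiner system.\<close>

lemma card_quintuples_UNIV: "card (quintuples UNIV) = 56 * 759"
  by (subst n_subsets) (simp_all add: binomial_fact' fact_numeral)

lemma card_octads_le: "card octads \<le> 759"
proof -
  have "card (\<Union>a\<in>octads. quintuples a) \<le> card (quintuples UNIV)"
    by (intro card_mono) auto
  then show ?thesis
    unfolding card_quintuples_octads card_quintuples_UNIV by simp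
qed

text \<open>The quintuples inside 759 octads are as many as all quintuples, so the packing is a
  covering.\<close>

lemma octad_containing:
  assumes "759 \<le> card octads" and "card F = 5"
  obtains a where "a \<in> octads" "F \<subseteq> a"
proof -
  have "(\<Union>a\<in>octads. quintuples a) = quintuples UNIV"
  proof (rule card_seteq)
    show "card (quintuples UNIV) \<le> card (\<Union>a\<in>octads. quintuples a)"
      unfolding card_quintuples_octads card_quintuples_UNIV using assms(1) by simp
  qed auto
  then have "F \<in> (\<Union>a\<in>octads. quintuples a)"
    using assms(2) by simp
  then show ?thesis using that by blast
qed

text \<open>Doubling turns orthogonality modulo 2 into orthogonality modulo 4:
  \<open>2 *s ind v\<close> lies in the dual, hence in \<open>C\<close>, and halving it inside
  \<open>C\<close> gives a word with residue \<open>v\<close>.\<close>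

lemma residue_self_dual:
  assumes "\<And>x. x \<in> C \<Longrightarrow> even (card (v \<inter> odd_supp x))"
  obtains y where "y \<in> C" "odd_supp y = v"
proof -
  have "scalar_product (2 *s ind v) x = 0" if "x \<in> C" for x
    using assms[OF that] double_scalar_product_ind[of x v]
    by (simp add: scalar_product_scale_left scalar_product_commute[of "ind v"])
  then have "2 *s ind v \<in> C"
    using dual by (auto simp: self_dual_def dual_code_def)
  then obtain y where "y \<in> C" "2 *s ind v = 2 *s y"
    using halvable odd_supp_double by metis
  then show ?thesis
    using that by (metis odd_supp_ind two_supp_double)
qed

text \<open>Only the permutation is recorded. A permutation admits several sign patterns, at least
  one and its negative, but the count of classes depends on the action on coordinates alone.\<close>

definition aut :: "(24 \<Rightarrow> 24) set" where
  "aut = {\<pi>. bij \<pi> \<and> (\<exists>\<epsilon>. range \<epsilon> \<subseteq> {1, -1} \<and> monomial \<pi> \<epsilon> ` C = C)}"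

lemma inv_in_aut:
  assumes "\<pi> \<in> aut"
  shows "inv \<pi> \<in> aut"
proof -
  obtain \<epsilon> where *: "bij \<pi>" "range \<epsilon> \<subseteq> {1, -1}" "monomial \<pi> \<epsilon> ` C = C"
    using assms unfolding aut_def by blast
  have "range (\<lambda>i. \<epsilon> (inv \<pi> i)) \<subseteq> {1, -1}"
    using *(2) by (simp add: image_subset_iff)
  moreover have "monomial (inv \<pi>) (\<lambda>i. \<epsilon> (inv \<pi> i)) ` C = C"
  proof -
    have "monomial (inv \<pi>) (\<lambda>i. \<epsilon> (inv \<pi> i)) ` monomial \<pi> \<epsilon> ` C = C"
      unfolding image_image monomial_inv[OF *(1,2)] by simp
    then show ?thesis unfolding *(3) .
  qed
  ultimately show ?thesis
    unfolding aut_def using bij_imp_bij_inv[OF *(1)] by blast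
qed

lemma comp_in_aut:
  assumes "\<pi> \<in> aut" "\<rho> \<in> aut"
  shows "\<pi> \<circ> \<rho> \<in> aut"
proof -
  obtain \<epsilon> where *: "bij \<pi>" "range \<epsilon> \<subseteq> {1, -1}" "monomial \<pi> \<epsilon> ` C = C"
    using assms unfolding aut_def by blast
  obtain \<delta> where **: "bij \<rho>" "range \<delta> \<subseteq> {1, -1}" "monomial \<rho> \<delta> ` C = C"
    using assms unfolding aut_def by blast
  have "monomial (\<pi> \<circ> \<rho>) (\<lambda>i. \<delta> i * \<epsilon> (\<rho> i)) ` C = monomial \<rho> \<delta> ` monomial \<pi> \<epsilon> ` C"
    by (simp only: image_image monomial_monomial)
  then have "monomial (\<pi> \<circ> \<rho>) (\<lambda>i. \<delta> i * \<epsilon> (\<rho> i)) ` C = C"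
    by (simp only: *(3) **(3))
  moreover have "range (\<lambda>i. \<delta> i * \<epsilon> (\<rho> i)) \<subseteq> {1, -1}"
    using *(2) **(2) by (rule sign_mult)
  moreover have "bij (\<pi> \<circ> \<rho>)"
    using *(1) **(1) by (rule bij_comp[rotated])
  ultimately show ?thesis
    unfolding aut_def mem_Collect_eq by blast
qed

text \<open>Translating by \<open>2 *s ind v\<close> adds 4 |v|, which vanishes modulo 8 for even
  |v|, and a cross term that equals 4 because the inner product with \<open>ind v\<close> is
  odd.\<close>

lemma euclid8_twist:
  assumes "x \<in> C" "even (card v)"
  shows "euclid8 (twist v x) = of_bool (odd (card (v \<inter> odd_supp x))) * 4"
proof (cases "odd (card (v \<inter> odd_supp x))")
  case True
  have "two_supp (2 *s ind v) = v" by (simp add: two_supp_double)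
  moreover have "8 dvd 4 * card v" using assms(2) by auto
  ultimately have "euclid8 (2 *s ind v) = 0"
    by (simp only: euclid8_eq odd_supp_double card.empty add_0 of_nat_8_eq_0_iff)
  moreover have "scalar_product x (2 *s ind v) = 2"
    using True double_scalar_product_ind[of x v] by (simp add: scalar_product_scale_right)
  ultimately show ?thesis
    using True type_II[OF assms(1)] by (simp add: twist_eq euclid8_add dbl8_def)
qed (simp add: twist_eq type_II[OF assms(1)])

text \<open>An equivalence preserves Euclidean weights, which recover \<open>v\<close> from \<open>twisted v C\<close> up to
  the residue code; hence it comes from an automorphism of \<open>C\<close>.\<close>

lemma equivalent_twisted:
  assumes eq: "equivalent_codes (twisted v C) (twisted w C)"
    and "even (card v)" "even (card w)"
  obtains \<pi> y where "\<pi> \<in> aut" "y \<in> C" "odd_supp y = sym_diff v (\<pi> ` w)"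
proof -
  obtain \<pi> \<epsilon> where bij: "bij \<pi>" and sign: "range \<epsilon> \<subseteq> {1, -1}"
    and im: "twisted w C = monomial \<pi> \<epsilon> ` twisted v C"
    using eq unfolding equivalent_codes_iff by blast
  note monomial_simps = odd_supp_monomial[OF bij sign] euclid8_monomial[OF bij sign]
    card_vimage[OF bij sign] twist_monomial[OF bij sign]
  let ?u = "\<pi> ` w"
  \<comment> \<open>The Euclidean weight of a twisted word is invariant under the monomial map, so
    \<open>v\<close> and the transported set \<open>?u\<close> have equal parities against every
    residue word.\<close>
  have parity: "odd (card (v \<inter> odd_supp x)) \<longleftrightarrow> odd (card (?u \<inter> odd_supp x))" if "x \<in> C" for x
  proof -
    have "monomial \<pi> \<epsilon> (twist v x) \<in> twisted w C"
      using that im by (auto simp: twisted_def)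
    then obtain y where y: "y \<in> C" "monomial \<pi> \<epsilon> (twist v x) = twist w y"
      unfolding twisted_def by blast
    have "\<pi> -` odd_supp x = odd_supp y"
      using arg_cong[OF y(2), of odd_supp] by (simp add: monomial_simps)
    then have "w \<inter> odd_supp y = \<pi> -` (?u \<inter> odd_supp x)"
      using bij_is_inj[OF bij] by (auto dest: injD)
    then have "card (w \<inter> odd_supp y) = card (?u \<inter> odd_supp x)"
      by (simp only: monomial_simps)
    moreover have "(of_bool (odd (card (v \<inter> odd_supp x))) * 4 :: 8) = of_bool (odd (card (w \<inter> odd_supp y))) * 4"
      using arg_cong[OF y(2), of euclid8] euclid8_twist assms(2,3) that y(1) by (simp only: monomial_simps)
    ultimately show ?thesis by (auto split: if_splits simp: of_bool_def)
  qed
  have even: "even (card (sym_diff v ?u \<inter> odd_supp x))" if "x \<in> C" for x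
  proof -
    have "sym_diff v ?u \<inter> odd_supp x = sym_diff (v \<inter> odd_supp x) (?u \<inter> odd_supp x)" by blast
    moreover have "even (card (sym_diff A B))" if "odd (card A) \<longleftrightarrow> odd (card B)" for A B :: "24 set"
      using card_sym_diff[of A B] that by (metis even_add even_mult_iff even_numeral finite)
    ultimately show ?thesis using parity[OF that] by simp
  qed
  then obtain y where y: "y \<in> C" "odd_supp y = sym_diff v ?u"
    using residue_self_dual by blast
  have in_C: "2 *s y \<in> C" "twist v (2 *s y) = 2 *s y"
    using scale_closed y(1) by (simp_all add: twist_eq)
  \<comment> \<open>The doubled indicators of \<open>v\<close> and \<open>?u\<close> agree modulo
    \<open>C\<close>, so that both sets twist \<open>C\<close> to the same code.\<close>
  have y2: "2 *s ind v = 2 *s ind ?u + 2 *s y"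
  proof -
    have "2 * of_bool (i \<in> v) = 2 * of_bool (i \<in> ?u) + 2 * y $ i" for i
    proof -
      have "i \<in> odd_supp y \<longleftrightarrow> (i \<in> v) \<noteq> (i \<in> ?u)" unfolding y(2) by blast
      then show ?thesis by (cases "y $ i" rule: Z4_cases) (auto simp: mem_odd_supp)
    qed
    then show ?thesis
      by (simp only: vec_eq_iff vector_add_component vector_smult_component ind_nth) blast
  qed
  \<comment> \<open>Where the twists are active they differ by \<open>2 *s y\<close>, a codeword
    without odd entries, which is therefore fixed by twisting.\<close>
  have twist_u: "twist ?u x \<in> twisted v C" if "x \<in> C" for x
  proof (cases "odd (card (v \<inter> odd_supp x))")
    case True
    have "twist v (x + 2 *s y) = twist v x + 2 *s y" by (simp only: twist_add in_C)
    also have "\<dots> = x + 2 *s ind v + 2 *s y" using True by (simp add: twist_eq)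
    also have "\<dots> = twist ?u x + (2 *s y + 2 *s y)"
      using True parity[OF that] by (simp add: twist_eq y2)
    also have "2 *s y + 2 *s y = 0" by (simp add: vec_eq_iff)
    finally have "twist ?u x = twist v (x + 2 *s y)" by simp
    then show ?thesis unfolding twisted_def using that in_C add_closed by blast
  next
    case False
    then have "twist ?u x = twist v x" using parity[OF that] by (simp add: twist_eq)
    then show ?thesis unfolding twisted_def using that by blast
  qed
  \<comment> \<open>Commuting the monomial map past the twist cancels the twists on both sides. An
    inclusion is enough, since \<open>C\<close> is finite and the map injective.\<close>
  have sub: "monomial \<pi> \<epsilon> ` C \<subseteq> C"
  proof
    fix x' assume "x' \<in> monomial \<pi> \<epsilon> ` C"
    then obtain x where x: "x \<in> C" "x' = monomial \<pi> \<epsilon> x" by blast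
    have "twist w x' = monomial \<pi> \<epsilon> (twist ?u x)" unfolding x(2) by (simp only: monomial_simps)
    then have "twist w x' \<in> twisted w C" using twist_u[OF x(1)] im by blast
    then show "x' \<in> C" by (simp add: mem_twisted_iff)
  qed
  have "inj (monomial \<pi> \<epsilon>)" using monomial_inv[OF bij sign] by (rule inj_on_inverseI)
  then have "card (monomial \<pi> \<epsilon> ` C) = card C" by (meson card_image inj_on_subset subset_UNIV)
  then have "monomial \<pi> \<epsilon> ` C = C" using sub by (intro card_subset_eq) auto
  then have "\<pi> \<in> aut" unfolding aut_def using bij sign by blast
  then show ?thesis using y that by blast
qed

end

section \<open>Counting equivalence classes\<close>

lemma card_24: "card (UNIV :: 24 set) = 24"
  by simp

text \<open>A largest set of pairwise unrelated elements dominates \<open>V\<close>, since an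
  element unrelated to all of it could be added. Hence \<open>card I\<close> neighbourhoods of size
  at most \<open>k\<close> cover \<open>V\<close>.\<close>

lemma independent_set:
  fixes V :: "'a set"
  assumes "finite V" and refl: "\<And>v. v \<in> V \<Longrightarrow> R v v"
    and sym: "\<And>v w. v \<in> V \<Longrightarrow> w \<in> V \<Longrightarrow> R v w \<Longrightarrow> R w v"
    and bound: "\<And>w. w \<in> V \<Longrightarrow> card {v\<in>V. R v w} \<le> k"
  obtains I where "I \<subseteq> V" "pairwise (\<lambda>v w. \<not> R v w) I" "card V \<le> k * card I"
proof -
  define indep where "indep I \<longleftrightarrow> I \<subseteq> V \<and> pairwise (\<lambda>v w. \<not> R v w) I" for I
  have "indep {}" by (simp add: indep_def)
  moreover have "\<forall>I. indep I \<longrightarrow> card I < Suc (card V)"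
    using assms(1) by (auto simp: indep_def less_Suc_eq_le intro: card_mono)
  ultimately obtain I where I: "indep I" and max: "\<And>J. indep J \<Longrightarrow> card J \<le> card I"
    using ex_has_greatest_nat[of indep "{}" card] by blast
  have "finite I" using I assms(1) by (auto simp: indep_def intro: finite_subset)
  have "V \<subseteq> (\<Union>w\<in>I. {v\<in>V. R v w})"
  proof
    fix v assume v: "v \<in> V"
    show "v \<in> (\<Union>w\<in>I. {v\<in>V. R v w})"
    proof (rule ccontr)
      assume *: "v \<notin> (\<Union>w\<in>I. {v\<in>V. R v w})"
      then have "v \<notin> I" using refl v by blast
      moreover have "indep (insert v I)"
        using I v * sym unfolding indep_def pairwise_insert by blast
      ultimately show False
        using max[of "insert v I"] \<open>finite I\<close> by simp
    qed
  qed
  then have "card V \<le> card (\<Union>w\<in>I. {v\<in>V. R v w})"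
    using \<open>finite I\<close> assms(1) by (intro card_mono) auto
  also have "\<dots> \<le> (\<Sum>w\<in>I. card {v\<in>V. R v w})"
    using \<open>finite I\<close> by (rule card_UN_le)
  also have "\<dots> \<le> (\<Sum>w\<in>I. k)"
    using I bound by (intro sum_mono) (auto simp: indep_def)
  finally have "card V \<le> k * card I" by (simp add: mult.commute)
  then show ?thesis using that I unfolding indep_def by blast
qed

text \<open>\<open>octad_word\<close> serves two ends: it excludes codewords of Lee weight 8, and
  for an octad that avoids \<open>z\<close> it supplies a 2 at \<open>z\<close> that twisting can
  remove.\<close>

locale rigid_code = residue_code +
  fixes z :: 24
  assumes card_octads: "759 \<le> card octads"
    and octad_word: "a \<in> octads \<Longrightarrow>
      \<exists>x\<in>C. odd_supp x = a \<and> card (two_supp x) = 2 \<and> (z \<in> a \<or> z \<in> two_supp x)"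
    and rigid: "\<pi> \<in> aut \<Longrightarrow> \<pi> z = z \<Longrightarrow> \<pi> = id"
begin

text \<open>Two automorphisms that agree at \<open>z\<close> differ by one that fixes
  \<open>z\<close>, so the image of \<open>z\<close> determines an automorphism.\<close>

lemma card_aut: "card aut \<le> 24"
proof -
  have "inj_on (\<lambda>\<pi>. \<pi> z) aut"
  proof (rule inj_onI)
    fix \<pi> \<rho> assume *: "\<pi> \<in> aut" "\<rho> \<in> aut" "\<pi> z = \<rho> z"
    then have bij: "bij \<pi>" by (simp add: aut_def)
    have "(inv \<pi> \<circ> \<rho>) z = z"
      using *(3)[symmetric] bij by (simp add: bij_is_inj)
    then have "inv \<pi> \<circ> \<rho> = id"
      using rigid comp_in_aut inv_in_aut *(1,2) by blast
    then have "\<pi> \<circ> (inv \<pi> \<circ> \<rho>) = \<pi>" by simp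
    moreover have "\<pi> \<circ> inv \<pi> = id" using bij bij_is_surj surj_iff by blast
    ultimately show "\<pi> = \<rho>" by (simp add: o_assoc)
  qed
  then have "card aut \<le> card (UNIV :: 24 set)"
    by (intro card_inj_on_le) auto
  then show ?thesis by simp
qed

section \<open>Lee weights of the code and of its neighbours\<close>

lemma two_supp_octad:
  assumes "x \<in> C" "card (odd_supp x) = 8"
  shows "two_supp x \<noteq> {}"
proof
  assume empty: "two_supp x = {}"
  obtain y where y: "y \<in> C" "odd_supp y = odd_supp x" "card (two_supp y) = 2"
    using octad_word assms unfolding octads_def by blast
  \<comment> \<open>The two-supports differ in only two positions, below the threshold of
    four.\<close>
  then have "two_supp x = two_supp y"
    using assms empty by (intro two_supp_determined) simp_all
  then show False using empty y(3) by simp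
qed

lemma euclid_dvd:
  assumes "euclid8 x = of_bool b * 4"
  shows "\<exists>m. card (odd_supp x) + 4 * card (two_supp x) = 8 * m + of_bool b * 4"
proof -
  let ?n = "card (odd_supp x) + 4 * card (two_supp x)"
  have "(of_nat (?n + of_bool b * 4) :: 8) = 0"
    using assms unfolding euclid8_eq by (cases b) simp_all
  then have "8 dvd ?n + of_bool b * 4" by (simp only: of_nat_8_eq_0_iff)
  then show ?thesis by (cases b) (simp_all, presburger+)
qed

text \<open>Even words are doubles and have Lee weight at least 16. Otherwise let n be the number of
  odd entries and m that of twos; n + 4m is divisible by 8, so n is a multiple of 4. If n = 8, then
  m is even and non-zero, which gives 8 + 4; if not, n is at least 12.\<close>

lemma lee_weight_ge_12:
  assumes "x \<in> C" "x \<noteq> 0"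
  shows "12 \<le> lee_weight x"
proof (cases "odd_supp x = {}")
  case True
  then obtain y where y: "y \<in> C" "x = 2 *s y" using halvable assms(1) by blast
  then have "odd_supp y \<noteq> {}"
    using assms(2) True odd_two_supp_empty two_supp_double by metis
  then show ?thesis
    using residue_weight[OF y(1)] by (simp add: lee_weight_eq y(2) two_supp_double)
next
  case False
  then have "8 \<le> card (odd_supp x)" using residue_weight assms(1) by blast
  moreover obtain m where m: "card (odd_supp x) + 4 * card (two_supp x) = 8 * m"
    using euclid_dvd[of x False] type_II[OF assms(1)] by auto
  moreover have "card (two_supp x) \<noteq> 0" if "card (odd_supp x) = 8"
    using two_supp_octad[OF assms(1) that] by simp
  ultimately show ?thesis unfolding lee_weight_eq by presburger
qed

text \<open>For a translated word n + 4m is 4 modulo 8, where n counts odd entries and m twos. If n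
  = 8, then m is odd, which gives 8 + 2; otherwise n is at least 12.\<close>

lemma lee_weight_twisted:
  assumes "even (card v)" "x \<in> twisted v C" "x \<noteq> 0"
  shows "10 \<le> lee_weight x"
proof -
  obtain y where y: "y \<in> C" "x = twist v y" using assms(2) by (auto simp: twisted_def)
  then have "y \<noteq> 0" using assms(3) by auto
  show ?thesis
  proof (cases "odd (card (v \<inter> odd_supp y))")
    case True
    then have "odd_supp y \<noteq> {}" by (metis Int_empty_right card.empty even_zero)
    then have "8 \<le> card (odd_supp x)" using residue_weight y by simp
    moreover obtain m where "card (odd_supp x) + 4 * card (two_supp x) = 8 * m + 4"
      using euclid_dvd[of x True] euclid8_twist[OF y(1) assms(1)] True y(2) by auto
    ultimately show ?thesis unfolding lee_weight_eq by presburger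
  next
    case False
    then have "x = y" using y(2) by (simp add: twist_eq)
    then show ?thesis using lee_weight_ge_12[OF y(1) \<open>y \<noteq> 0\<close>] by simp
  qed
qed

text \<open>Modulo the Golay code a set of four points is congruent to exactly the other five
  tetrads of its sextet, and one of the six contains \<open>z\<close>. So this family represents
  each of the 1771 = C(23,3) sextets once.\<close>

definition tetrads :: "24 set set" where
  "tetrads = insert z ` {t. t \<subseteq> - {z} \<and> card t = 3}"

lemma tetrads_card: "v \<in> tetrads \<Longrightarrow> card v = 4"
  by (auto simp: tetrads_def card_insert_if subset_iff)

lemma card_tetrads: "card tetrads = 1771"
proof -
  have "inj_on (insert z) {t. t \<subseteq> - {z} \<and> card t = 3}"
    by (rule inj_onI) blast
  then have "card tetrads = card {t::24 set. t \<subseteq> - {z} \<and> card t = 3}"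
    unfolding tetrads_def by (rule card_image)
  also have "\<dots> = 23 choose 3"
    by (subst n_subsets) (simp_all add: Compl_eq_Diff_UNIV)
  finally show ?thesis by (simp add: binomial_fact' fact_numeral)
qed

text \<open>The witness lies over an octad \<open>b\<close> that contains \<open>t\<close> but not
  \<open>z\<close>. To find it, take an octad \<open>a\<close> through \<open>v\<close> and a new
  point \<open>d\<close>, then \<open>b\<close> through \<open>t\<close>, \<open>d\<close> and a
  point \<open>e\<close> outside \<open>a\<close>; if \<open>z\<close> were in \<open>b\<close>, the
  two octads would share five points and coincide.\<close>

lemma min_lee_weight_twisted:
  assumes "v \<in> tetrads"
  shows "min_lee_weight (twisted v C) = 10"
proof -
  obtain t where t: "v = insert z t" "z \<notin> t" "card t = 3"
    using assms unfolding tetrads_def by blast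
  have outside: "\<exists>e. e \<notin> A" if "card A < 24" for A :: "24 set"
    using that by (metis UNIV_eq_I card_24 less_irrefl)
  have "card (insert z t) = 4" using t by simp
  then obtain d where d: "d \<notin> insert z t" using outside[of "insert z t"] by auto
  then have "card (insert d (insert z t)) = 5" using t by simp
  then obtain a where a: "a \<in> octads" "insert d (insert z t) \<subseteq> a"
    using octad_containing card_octads by blast
  then obtain e where e: "e \<notin> a" using outside[of a] by (auto simp: octads_def)
  then have "card (insert e (insert d t)) = 5" using t d a(2) by (subst card_insert_disjoint) auto
  then obtain b where b: "b \<in> octads" "insert e (insert d t) \<subseteq> b"
    using octad_containing card_octads by blast
  have "z \<notin> b"
  proof
    assume "z \<in> b"
    then have "card (insert d (insert z t)) \<le> card (a \<inter> b)"
      using a(2) b(2) by (intro card_mono) auto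
    then have "a = b"
      using octads_inter a(1) b(1) \<open>card (insert d (insert z t)) = 5\<close> by simp
    then show False using e b(2) by blast
  qed
  then obtain x where x: "x \<in> C" "odd_supp x = b" "card (two_supp x) = 2" "z \<in> two_supp x"
    using octad_word[OF b(1)] by blast
  have vb: "v \<inter> odd_supp x = t"
    using t(1) \<open>z \<notin> b\<close> b(2) x(2) by blast
  have "two_supp (x + 2 *s ind v) = two_supp x - {z}"
  proof -
    \<comment> \<open>On \<open>t\<close> the translation exchanges 1 and 3, and at \<open>z\<close>
      it replaces 2 by 0; exactly one of the two twos survives.\<close>
    have "x $ i + 2 * of_bool (i \<in> v) = 2 \<longleftrightarrow> x $ i = 2 \<and> i \<noteq> z" for i
    proof (cases "i \<in> v")
      case True
      then have "i = z \<and> x $ i = 2 \<or> i \<noteq> z \<and> (x $ i = 1 \<or> x $ i = 3)"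
        using x(4) vb t(1) by (auto simp: mem_two_supp[symmetric] mem_odd_supp[symmetric])
      then show ?thesis using True by auto
    next
      case False
      then have "i \<noteq> z" using t(1) by blast
      then show ?thesis using False by simp
    qed
    then show ?thesis
      unfolding two_supp_def vector_add_component vector_smult_component ind_nth by blast
  qed
  moreover have tw: "twist v x = x + 2 *s ind v"
    using vb t(3) by (simp add: twist_eq)
  ultimately have "card (two_supp (twist v x)) = 1" using x(3,4) by simp
  moreover have "card b = 8" using b(1) by (auto simp: octads_def)
  ultimately have "lee_weight (twist v x) = 10" by (simp add: lee_weight_eq x(2))
  moreover have "twist v x \<noteq> 0"
  proof
    assume "twist v x = 0"
    then have "odd_supp (twist v x) = {}" by simp
    then show False using x(2) \<open>card b = 8\<close> by simp
  qed
  moreover have "twist v x \<in> twisted v C" using x(1) by (simp add: twisted_def)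
  ultimately have "10 \<in> lee_weight ` (twisted v C - {0})" by (metis DiffI image_eqI singletonD)
  moreover have "even (card v)" using tetrads_card[OF assms] by simp
  ultimately show ?thesis
    unfolding min_lee_weight_def using lee_weight_twisted by (intro Min_eqI) auto
qed

lemma twisted_classes:
  obtains S :: "(Z4 ^ 24) set set" where "finite S" "60 \<le> card S"
    "\<forall>D\<in>S. Z4_code D \<and> self_dual D \<and> min_lee_weight D = 10"
    "pairwise (\<lambda>D E. \<not> equivalent_codes D E) S"
proof -
  define R where "R v w \<longleftrightarrow> equivalent_codes (twisted v C) (twisted w C)" for v w
  \<comment> \<open>The shared point \<open>z\<close> leaves at most 6 elements in the symmetric
    difference, too few for a non-zero residue word.\<close>
  have eq: "v = v'" if "v \<in> tetrads" "v' \<in> tetrads" "y \<in> C" "y' \<in> C"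
    "odd_supp y = sym_diff v u" "odd_supp y' = sym_diff v' u" for v v' u y y'
  proof -
    have "odd_supp (y + y') = sym_diff v v'"
      unfolding odd_supp_add that by blast
    moreover have "card (sym_diff v v') < 8"
    proof -
      have "z \<in> v \<inter> v'" using that(1,2) by (auto simp: tetrads_def)
      then have "0 < card (v \<inter> v')" by (metis card_gt_0_iff empty_iff finite)
      then show ?thesis
        using card_sym_diff[of v v'] tetrads_card that(1,2) by simp
    qed
    ultimately have "sym_diff v v' = {}"
      using residue_weight[of "y + y'"] add_closed that(3,4) by fastforce
    then show ?thesis by blast
  qed
  have bound: "card {v \<in> tetrads. R v w} \<le> 24" if w: "w \<in> tetrads" for w
  proof -
    have "\<exists>\<pi>\<in>aut. \<exists>y\<in>C. odd_supp y = sym_diff v (\<pi> ` w)" if "v \<in> tetrads" "R v w" for v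
      using equivalent_twisted[of v w] that w tetrads_card[of v] tetrads_card[of w] unfolding R_def
      by (metis even_numeral)
    then obtain p where p: "\<And>v. v \<in> tetrads \<Longrightarrow> R v w \<Longrightarrow>
        p v \<in> aut \<and> (\<exists>y\<in>C. odd_supp y = sym_diff v (p v ` w))"
      by metis
    \<comment> \<open>With \<open>w\<close> fixed, the automorphism determines the class of
      \<open>v\<close> modulo the residue code, hence \<open>v\<close> itself.\<close>
    have "inj_on p {v \<in> tetrads. R v w}"
    proof (rule inj_onI)
      fix v v' assume *: "v \<in> {v \<in> tetrads. R v w}" "v' \<in> {v \<in> tetrads. R v w}" "p v = p v'"
      obtain y where "y \<in> C" "odd_supp y = sym_diff v (p v ` w)"
        using p[of v] *(1) by blast
      moreover obtain y' where "y' \<in> C" "odd_supp y' = sym_diff v' (p v ` w)"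
        using p[of v'] *(2) unfolding *(3) by blast
      ultimately show "v = v'" using eq[of v v' y y'] *(1,2) by blast
    qed
    then have "card {v \<in> tetrads. R v w} \<le> card aut"
      using p by (intro card_inj_on_le) auto
    then show ?thesis using card_aut by simp
  qed
  have R_refl: "R v v" and R_sym: "R v w \<Longrightarrow> R w v" for v w
    unfolding R_def by (rule equivalent_codes_refl, rule equivalent_codes_sym)
  obtain I where I: "I \<subseteq> tetrads" "pairwise (\<lambda>v w. \<not> R v w) I" "card tetrads \<le> 24 * card I"
    using independent_set[of tetrads R 24, OF finite R_refl R_sym bound] by blast
  let ?S = "(\<lambda>v. twisted v C) ` I"
  have pw: "pairwise (\<lambda>D E. \<not> equivalent_codes D E) ?S"
  proof (rule pairwiseI)
    fix D E assume "D \<in> ?S" "E \<in> ?S" "D \<noteq> E"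
    then obtain v w where *: "v \<in> I" "w \<in> I" "D = twisted v C" "E = twisted w C" "v \<noteq> w"
      by blast
    then show "\<not> equivalent_codes D E"
      using pairwiseD[OF I(2) *(1,2,5)] unfolding R_def *(3,4) by blast
  qed
  have "inj_on (\<lambda>v. twisted v C) I"
  proof (rule inj_onI, rule ccontr)
    fix v w assume *: "v \<in> I" "w \<in> I" "twisted v C = twisted w C" "v \<noteq> w"
    have "R v w" unfolding R_def *(3) by (rule equivalent_codes_refl)
    then show False using pairwiseD[OF I(2) *(1,2,4)] by blast
  qed
  then have "card ?S = card I" by (rule card_image)
  then have card: "60 \<le> card ?S" using I(3) card_tetrads by simp
  have "\<forall>D\<in>?S. Z4_code D \<and> self_dual D \<and> min_lee_weight D = 10"
    using I(1) min_lee_weight_twisted code dual Z4_code_twisted self_dual_twisted by blast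
  moreover have "finite ?S" by simp
  ultimately show ?thesis using card pw by (intro that[of ?S])
qed

end

section \<open>Automorphisms fixing a coordinate\<close>

context residue_code
begin

text \<open>The list attached to \<open>q\<close>. For \<open>q = z\<close> it would ask for a
  single 2, which \<open>type_II\<close> excludes next to eight odd entries.\<close>

definition partners :: "24 \<Rightarrow> 24 \<Rightarrow> 24 set set" where
  "partners z q = {odd_supp x |x. x \<in> C \<and> card (odd_supp x) = 8 \<and> two_supp x = {z, q}}"

lemma partners_octads: "partners z q \<subseteq> octads"
  by (auto simp: partners_def octads_def)

lemma partners_not_mem: "a \<in> partners z q \<Longrightarrow> z \<notin> a"
  using odd_two_supp_disjoint by (fastforce simp: partners_def)

text \<open>The 2 at \<open>z\<close> is common to both words, so their two-supports can differ only
  at \<open>p\<close> and \<open>q\<close>, again fewer than four places.\<close>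

lemma partners_disjoint:
  assumes "a \<in> partners z p" "a \<in> partners z q" "p \<noteq> z" "q \<noteq> z"
  shows "p = q"
proof -
  obtain x y where xy: "x \<in> C" "y \<in> C" "a = odd_supp x" "a = odd_supp y" "card a = 8"
    "two_supp x = {z, p}" "two_supp y = {z, q}"
    using assms(1,2) unfolding partners_def by blast
  have "card (sym_diff (two_supp x) (two_supp y)) \<le> card {p, q}"
    unfolding xy by (intro card_mono) auto
  also have "\<dots> < 4" by (simp add: card_insert_if)
  finally have "two_supp x = two_supp y"
    using xy(1-5) by (intro two_supp_determined) simp_all
  then show ?thesis using xy(6,7) assms(3,4) by blast
qed

lemma vimage_partners:
  assumes "\<pi> \<in> aut" "\<pi> z = z" "a \<in> partners z (\<pi> q)"
  shows "\<pi> -` a \<in> partners z q"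
proof -
  obtain \<epsilon> where *: "bij \<pi>" "range \<epsilon> \<subseteq> {1, -1}" "monomial \<pi> \<epsilon> ` C = C"
    using assms(1) unfolding aut_def by blast
  obtain x where x: "x \<in> C" "a = odd_supp x" "card a = 8" "two_supp x = {z, \<pi> q}"
    using assms(3) unfolding partners_def by blast
  have "\<pi> i = z \<longleftrightarrow> i = z" "\<pi> i = \<pi> q \<longleftrightarrow> i = q" for i
    using inj_eq[OF bij_is_inj[OF *(1)]] assms(2) by metis+
  then have "two_supp (monomial \<pi> \<epsilon> x) = {z, q}"
    unfolding two_supp_monomial[OF *(1,2)] x(4) by auto
  moreover have "odd_supp (monomial \<pi> \<epsilon> x) = \<pi> -` a" "card (\<pi> -` a) = 8"
    using x(3) by (simp_all add: odd_supp_monomial[OF *(1,2)] card_vimage[OF *(1,2)] x(2))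
  moreover have "monomial \<pi> \<epsilon> x \<in> C" using *(3) x(1) by blast
  ultimately show ?thesis unfolding partners_def mem_Collect_eq by metis
qed

text \<open>Automorphisms that fix \<open>z\<close> permute the lists as they permute the
  coordinates. Pulling back along \<pi> gives one inclusion and along its inverse the other.\<close>

lemma image_partners:
  assumes "\<pi> \<in> aut" "\<pi> z = z"
  shows "partners z (\<pi> q) = (`) \<pi> ` partners z q"
proof -
  have bij: "bij \<pi>" using assms(1) by (simp add: aut_def)
  then have inv: "inv \<pi> (\<pi> i) = i" for i by (simp add: bij_is_inj)
  have "\<pi> ` a \<in> partners z (\<pi> q)" if "a \<in> partners z q" for a
  proof -
    have "inv \<pi> -` a \<in> partners z (\<pi> q)"
      using vimage_partners[OF inv_in_aut[OF assms(1)], of z a "\<pi> q"] inv assms(2) that by metis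
    moreover have "inv \<pi> -` a = \<pi> ` a"
      using bij by (simp add: bij_vimage_eq_inv_image bij_imp_bij_inv inv_inv_eq)
    ultimately show ?thesis by simp
  qed
  moreover have "a \<in> (`) \<pi> ` partners z q" if "a \<in> partners z (\<pi> q)" for a
  proof -
    have "a = \<pi> ` (\<pi> -` a)" using bij by (simp add: bij_is_surj surj_image_vimage_eq)
    then show ?thesis using vimage_partners[OF assms that] by blast
  qed
  ultimately show ?thesis by blast
qed

text \<open>Distinct octads meet in 0, 2 or 4 points; this counts the ordered pairs in the list that
  meet in 4. For the chosen code the value 182 recurs, so a finer invariant is needed.\<close>

definition weight :: "24 \<Rightarrow> 24 \<Rightarrow> int" where
  "weight z q = (\<Sum>a\<in>partners z q. int (card {b \<in> partners z q. card (a \<inter> b) = 4}))"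

text \<open>A second round of the same refinement, with the points marked by their weights. Without
  the square the sum would see only how many octads of the list contain each point.\<close>

definition weight_profile :: "24 \<Rightarrow> 24 \<Rightarrow> int" where
  "weight_profile z q = (\<Sum>a\<in>partners z q. (\<Sum>i\<in>a. weight z i)\<^sup>2)"

lemma weight_aut:
  assumes "\<pi> \<in> aut" "\<pi> z = z"
  shows "weight z (\<pi> q) = weight z q"
proof -
  have inj: "inj \<pi>" using assms(1) by (simp add: aut_def bij_is_inj)
  then have inj2: "inj_on ((`) \<pi>) A" for A by (meson inj_image_eq_iff inj_onI)
  have "card {b \<in> (`) \<pi> ` partners z q. card (\<pi> ` a \<inter> b) = 4} = card {b \<in> partners z q. card (a \<inter> b) = 4}" for a
  proof -
    have "card (\<pi> ` a \<inter> \<pi> ` b) = card (a \<inter> b)" for b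
      using inj by (metis card_image image_Int inj_on_subset subset_UNIV)
    then have "{b \<in> (`) \<pi> ` partners z q. card (\<pi> ` a \<inter> b) = 4} = (`) \<pi> ` {b \<in> partners z q. card (a \<inter> b) = 4}"
      by auto
    then show ?thesis using card_image[OF inj2] by simp
  qed
  then show ?thesis
    unfolding weight_def image_partners[OF assms] sum.reindex[OF inj2] by simp
qed

lemma weight_profile_aut:
  assumes "\<pi> \<in> aut" "\<pi> z = z"
  shows "weight_profile z (\<pi> q) = weight_profile z q"
proof -
  have inj: "inj \<pi>" using assms(1) by (simp add: aut_def bij_is_inj)
  then have inj2: "inj_on ((`) \<pi>) A" for A by (meson inj_image_eq_iff inj_onI)
  have "(\<Sum>i\<in>\<pi> ` a. weight z i) = (\<Sum>i\<in>a. weight z i)" for a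
    using inj by (subst sum.reindex) (auto simp: weight_aut[OF assms] intro: inj_on_subset)
  then show ?thesis
    unfolding weight_profile_def image_partners[OF assms] sum.reindex[OF inj2] by simp
qed

lemma rigid_if_inj_weight_profile:
  assumes "inj_on (weight_profile z) (- {z})" "\<pi> \<in> aut" "\<pi> z = z"
  shows "\<pi> = id"
proof
  fix q
  show "\<pi> q = id q"
  proof (cases "q = z")
    case False
    have "inj \<pi>" using assms(2) by (simp add: aut_def bij_is_inj)
    then have "\<pi> q \<noteq> z" using False assms(3) by (metis injD)
    then show ?thesis
      using inj_onD[OF assms(1) weight_profile_aut[OF assms(2,3), of q]] False by simp
  qed (simp add: assms(3))
qed

end

section \<open>The lifted Golay code and its certificate\<close>

text \<open>A free copy of the integers modulo 4, with \<open>M\<close> for -1. Arithmetic by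
  pattern matching lets \<open>code_simp\<close> evaluate the checks without the representation of
  the numeral type.\<close>

datatype digit = Z | I | T | M

fun val :: "digit \<Rightarrow> Z4" where
  "val Z = 0" | "val I = 1" | "val T = 2" | "val M = 3"

fun dadd :: "digit \<Rightarrow> digit \<Rightarrow> digit" where
  "dadd Z y = y" | "dadd x Z = x"
| "dadd I I = T" | "dadd I T = M" | "dadd I M = Z"
| "dadd T I = M" | "dadd T T = Z" | "dadd T M = I"
| "dadd M I = Z" | "dadd M T = I" | "dadd M M = T"

fun dmul :: "digit \<Rightarrow> digit \<Rightarrow> digit" where
  "dmul Z y = Z" | "dmul I y = y" | "dmul T y = dadd y y" | "dmul M y = dadd y (dadd y y)"

fun vadd :: "digit list \<Rightarrow> digit list \<Rightarrow> digit list" where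
  "vadd (x # xs) (y # ys) = dadd x y # vadd xs ys"
| "vadd _ _ = []"

fun dot :: "digit list \<Rightarrow> digit list \<Rightarrow> digit" where
  "dot (x # xs) (y # ys) = dadd (dmul x y) (dot xs ys)"
| "dot _ _ = Z"

text \<open>Coefficients act by repeated row addition, and the zeros that predominate in the listed
  messages cost nothing.\<close>

fun combine :: "digit list \<Rightarrow> digit list list \<Rightarrow> digit list \<Rightarrow> digit list" where
  "combine (a # as) (r # rs) acc = combine as rs
    (case a of Z \<Rightarrow> acc | I \<Rightarrow> vadd r acc | T \<Rightarrow> vadd r (vadd r acc) | M \<Rightarrow> vadd r (vadd r (vadd r acc)))"
| "combine _ _ acc = acc"

text \<open>A bordered circulant matrix that is symmetric and has square -1; it was found by looking for
  4-frames in the Leech lattice.\<close>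

definition matrix :: "digit list list" where
  "matrix =
   [[Z,Z,Z,M,T,M,M,T,I,M,I,I],
    [Z,Z,M,T,M,M,T,I,M,I,Z,I],
    [Z,M,T,M,M,T,I,M,I,Z,Z,I],
    [M,T,M,M,T,I,M,I,Z,Z,Z,I],
    [T,M,M,T,I,M,I,Z,Z,Z,M,I],
    [M,M,T,I,M,I,Z,Z,Z,M,T,I],
    [M,T,I,M,I,Z,Z,Z,M,T,M,I],
    [T,I,M,I,Z,Z,Z,M,T,M,M,I],
    [I,M,I,Z,Z,Z,M,T,M,M,T,I],
    [M,I,Z,Z,Z,M,T,M,M,T,I,I],
    [I,Z,Z,Z,M,T,M,M,T,I,M,I],
    [I,I,I,I,I,I,I,I,I,I,I,T]]"

definition codeword :: "digit list \<Rightarrow> digit list" where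
  "codeword a = a @ combine a matrix (replicate 12 Z)"

definition unit :: "nat \<Rightarrow> digit list" where
  "unit k = (replicate 12 Z)[k := I]"

definition odd_digit :: "digit \<Rightarrow> bool" where
  "odd_digit d \<longleftrightarrow> d = I \<or> d = M"

definition count_odd :: "digit list \<Rightarrow> nat" where
  "count_odd w = length (filter odd_digit w)"

definition count_two :: "digit list \<Rightarrow> nat" where
  "count_two w = length (filter (\<lambda>d. d = T) w)"

definition basis1 :: "digit list list" where
  "basis1 = map (\<lambda>k. codeword (unit k)) [0..<12]"

text \<open>Multiplying the generator matrix (1 | A) by -A gives (-A | -A^2) = (-A | 1), since A has
  square -1. This basis is systematic in the last twelve coordinates.\<close>

definition basis2 :: "digit list list" where
  "basis2 = map (\<lambda>r. codeword (map (dmul M) r)) matrix"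

lemma matrix_shape: "length matrix = 12 \<and> list_all (\<lambda>r. length r = 12) matrix"
  by code_simp

lemma basis1_orthogonal: "list_all (\<lambda>x. list_all (\<lambda>y. dot x y = Z) basis1) basis1"
  by code_simp

lemma basis1_euclid: "list_all (\<lambda>x. 8 dvd count_odd x + 4 * count_two x) basis1"
  by code_simp

lemma basis2_systematic: "map (drop 12) basis2 = map unit [0..<12]"
  by code_simp

text \<open>A residue word of weight 4 has at most two odd entries in one of the halves, so modulo 2
  it is a sum of at most two vectors of the basis systematic there. Checking single vectors and
  pairs is enough.\<close>

definition no_weight_4 :: "digit list list \<Rightarrow> bool" where
  "no_weight_4 bs \<longleftrightarrow> list_all (\<lambda>x. count_odd x \<noteq> 4 \<and> list_all (\<lambda>y. count_odd (vadd x y) \<noteq> 4) bs) bs"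

lemma basis1_weight: "no_weight_4 basis1"
  by code_simp

lemma basis2_weight: "no_weight_4 basis2"
  by code_simp

text \<open>Codewords are listed by their first 12 coordinates. Numbering the lists from 1, each word of
  the \<open>q\<close>-th list has its only twos at the coordinates 0 and \<open>q\<close>; the words of \<open>base_words\<close> are
  odd at 0. Together they realise all 759 octads.\<close>

definition partner_words :: "digit list list list" where
  "partner_words =
  [[[T,T,Z,Z,Z,Z,Z,Z,Z,Z,I,M], [T,T,Z,Z,Z,Z,I,Z,Z,M,Z,Z], [T,T,Z,Z,Z,I,Z,Z,M,M,I,Z],
    [T,T,Z,Z,Z,I,Z,I,Z,I,Z,Z], [T,T,Z,Z,Z,I,Z,M,Z,M,M,M], [T,T,Z,Z,Z,I,M,Z,I,Z,Z,Z],
    [T,T,Z,Z,Z,I,I,I,Z,Z,M,I], [T,T,Z,Z,I,Z,Z,Z,M,Z,Z,Z], [T,T,Z,Z,I,Z,Z,Z,I,Z,Z,I],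
    [T,T,Z,Z,I,Z,Z,Z,M,Z,M,Z], [T,T,Z,I,Z,Z,Z,Z,M,I,Z,Z], [T,T,Z,I,Z,Z,I,I,Z,Z,Z,M],
    [T,T,Z,I,Z,M,Z,Z,Z,Z,Z,Z], [T,T,Z,I,I,Z,Z,Z,Z,M,I,I], [T,T,I,Z,Z,I,I,M,Z,I,I,Z],
    [T,T,I,Z,M,Z,Z,I,Z,M,Z,Z], [T,T,I,Z,M,Z,M,Z,M,Z,Z,I], [T,T,I,Z,I,Z,M,I,Z,Z,Z,M],
    [T,T,I,I,Z,Z,Z,Z,I,Z,Z,Z], [T,T,I,I,Z,Z,Z,M,Z,Z,M,Z], [T,T,I,M,Z,M,I,Z,Z,Z,Z,Z],
    [T,T,I,M,I,Z,Z,Z,Z,Z,Z,Z]],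
   [[T,Z,T,Z,Z,Z,Z,Z,I,Z,M,Z], [T,Z,T,Z,Z,Z,I,Z,I,Z,Z,I], [T,Z,T,Z,Z,Z,I,I,Z,M,M,Z],
    [T,Z,T,Z,Z,I,I,Z,Z,Z,Z,I], [T,Z,T,Z,I,Z,M,Z,Z,Z,M,I], [T,Z,T,Z,I,Z,I,M,M,I,Z,Z],
    [T,Z,T,Z,I,I,Z,I,Z,Z,I,Z], [T,Z,T,Z,I,M,I,I,Z,Z,Z,M], [T,Z,T,I,Z,Z,Z,Z,Z,Z,Z,I],
    [T,Z,T,I,Z,Z,Z,Z,Z,M,Z,Z], [T,Z,T,I,Z,Z,Z,Z,I,I,I,Z], [T,Z,T,I,Z,Z,M,I,M,Z,Z,Z],
    [T,Z,T,I,M,Z,I,Z,M,Z,Z,Z], [T,Z,T,I,I,I,Z,M,Z,Z,M,M], [T,I,T,Z,Z,Z,Z,Z,I,Z,Z,M],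
    [T,I,T,Z,Z,Z,Z,M,Z,M,I,Z], [T,I,T,Z,Z,I,Z,Z,Z,M,Z,Z], [T,I,T,Z,Z,I,Z,I,Z,I,Z,Z],
    [T,I,T,Z,M,Z,Z,Z,Z,I,M,Z], [T,I,T,Z,I,M,Z,Z,Z,Z,Z,I], [T,I,T,M,Z,Z,Z,Z,M,Z,Z,Z],
    [T,I,T,I,Z,M,Z,Z,Z,Z,Z,Z]],
   [[T,Z,Z,T,Z,Z,Z,Z,I,Z,Z,Z], [T,Z,Z,T,Z,Z,Z,Z,I,Z,I,I], [T,Z,Z,T,Z,Z,Z,I,Z,Z,Z,Z],
    [T,Z,Z,T,Z,Z,Z,I,Z,Z,Z,M], [T,Z,Z,T,Z,I,Z,Z,Z,Z,M,Z], [T,Z,Z,T,Z,I,Z,M,M,I,Z,Z],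
    [T,Z,Z,T,Z,I,I,Z,Z,M,M,Z], [T,Z,Z,T,I,I,Z,Z,I,Z,Z,Z], [T,Z,I,T,Z,Z,Z,Z,Z,I,M,Z],
    [T,Z,I,T,Z,Z,I,Z,Z,Z,Z,M], [T,Z,I,T,Z,Z,M,M,Z,M,Z,I], [T,Z,I,T,I,Z,I,Z,Z,Z,I,Z],
    [T,Z,I,T,I,M,Z,Z,M,Z,Z,Z], [T,Z,I,T,M,M,Z,Z,I,Z,M,Z], [T,I,Z,T,Z,Z,Z,I,Z,M,Z,Z],
    [T,I,Z,T,Z,Z,Z,I,M,Z,Z,I], [T,I,Z,T,Z,Z,I,M,Z,M,Z,Z], [T,I,Z,T,I,Z,Z,Z,I,I,Z,Z],
    [T,I,Z,T,I,Z,M,Z,Z,Z,M,Z], [T,I,Z,T,M,Z,I,Z,Z,I,Z,I], [T,I,M,T,Z,M,Z,M,Z,Z,Z,M],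
    [T,I,I,T,M,I,M,Z,Z,Z,I,M]],
   [[T,Z,Z,Z,T,Z,I,Z,Z,Z,Z,Z], [T,Z,Z,Z,T,Z,I,M,Z,Z,Z,Z], [T,Z,Z,Z,T,I,Z,Z,Z,M,I,Z],
    [T,Z,Z,Z,T,I,M,Z,Z,Z,Z,Z], [T,Z,Z,I,T,Z,Z,Z,Z,I,Z,M], [T,Z,Z,I,T,Z,Z,M,M,Z,Z,Z],
    [T,Z,Z,I,T,Z,M,I,Z,Z,I,I], [T,Z,Z,I,T,Z,I,I,Z,M,Z,M], [T,Z,I,Z,T,Z,Z,Z,Z,M,Z,Z],
    [T,Z,I,Z,T,Z,Z,Z,I,Z,Z,M], [T,Z,I,Z,T,Z,Z,M,Z,Z,I,Z], [T,Z,I,Z,T,M,M,Z,M,Z,Z,M],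
    [T,Z,I,I,T,Z,Z,Z,Z,Z,Z,I], [T,Z,I,M,T,I,Z,I,M,Z,M,Z], [T,I,Z,Z,T,Z,I,I,M,I,I,Z],
    [T,I,Z,Z,T,M,Z,Z,Z,Z,M,I], [T,I,Z,Z,T,I,Z,Z,I,Z,Z,Z], [T,I,Z,Z,T,I,Z,M,M,Z,Z,Z],
    [T,I,Z,I,T,Z,Z,Z,Z,M,M,Z], [T,I,Z,M,T,M,Z,Z,Z,M,I,Z], [T,I,I,Z,T,Z,Z,Z,I,I,Z,Z],
    [T,I,M,Z,T,Z,M,Z,Z,Z,Z,M]],
   [[T,Z,Z,Z,Z,T,Z,Z,Z,I,M,Z], [T,Z,Z,Z,Z,T,Z,Z,I,M,M,Z], [T,Z,Z,Z,Z,T,I,I,Z,M,Z,Z],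
    [T,Z,Z,Z,I,T,Z,I,Z,Z,Z,I], [T,Z,Z,Z,I,T,I,M,M,Z,Z,Z], [T,Z,Z,I,Z,T,Z,Z,I,Z,I,I],
    [T,Z,Z,I,Z,T,I,Z,Z,Z,Z,M], [T,Z,Z,I,Z,T,M,M,Z,M,M,Z], [T,Z,I,Z,Z,T,Z,Z,I,Z,I,Z],
    [T,Z,I,Z,Z,T,I,Z,Z,I,M,I], [T,Z,I,Z,Z,T,M,Z,M,Z,I,Z], [T,Z,I,Z,Z,T,M,I,Z,Z,M,Z],
    [T,Z,I,Z,M,T,I,Z,Z,M,Z,Z], [T,Z,I,M,I,T,Z,M,I,Z,Z,Z], [T,I,Z,Z,M,T,Z,Z,Z,Z,Z,Z],
    [T,I,Z,Z,I,T,Z,Z,Z,Z,Z,M], [T,I,Z,Z,M,T,Z,Z,Z,I,Z,Z], [T,I,Z,M,Z,T,Z,Z,M,M,Z,I],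
    [T,I,Z,I,Z,T,Z,M,Z,Z,Z,I], [T,I,Z,I,I,T,Z,I,Z,Z,Z,Z], [T,I,I,Z,Z,T,Z,Z,Z,Z,Z,M],
    [T,I,M,M,Z,T,Z,Z,I,Z,Z,Z]],
   [[T,Z,Z,Z,Z,Z,T,I,Z,Z,M,Z], [T,Z,Z,Z,Z,Z,T,I,Z,Z,I,M], [T,Z,Z,Z,Z,Z,T,I,I,Z,Z,M],
    [T,Z,Z,Z,I,Z,T,I,Z,Z,M,Z], [T,Z,Z,Z,I,M,T,Z,Z,Z,Z,Z], [T,Z,Z,I,Z,Z,T,I,M,M,Z,Z],
    [T,Z,Z,I,Z,I,T,Z,Z,I,Z,I], [T,Z,Z,I,Z,I,T,Z,I,Z,Z,Z], [T,Z,Z,I,I,Z,T,M,Z,I,Z,M],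
    [T,Z,Z,I,M,M,T,Z,Z,Z,Z,Z], [T,Z,I,Z,Z,Z,T,Z,Z,Z,I,I], [T,Z,I,Z,Z,Z,T,M,Z,M,Z,M],
    [T,Z,I,Z,Z,Z,T,I,Z,I,I,Z], [T,Z,I,M,Z,Z,T,Z,M,I,M,Z], [T,I,Z,Z,Z,Z,T,Z,Z,I,Z,M],
    [T,I,Z,Z,M,Z,T,Z,I,Z,M,Z], [T,I,Z,Z,I,M,T,Z,I,Z,Z,I], [T,I,Z,I,Z,M,T,Z,M,Z,Z,Z],
    [T,I,M,Z,Z,I,T,Z,M,Z,Z,Z], [T,I,I,Z,M,Z,T,Z,Z,Z,Z,Z], [T,I,I,Z,I,I,T,Z,Z,M,Z,Z],
    [T,I,M,M,Z,Z,T,Z,Z,Z,I,Z]],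
   [[T,Z,Z,Z,Z,Z,Z,T,Z,I,I,I], [T,Z,Z,Z,Z,I,Z,T,Z,Z,I,M], [T,Z,Z,Z,Z,I,Z,T,Z,M,Z,Z],
    [T,Z,Z,Z,Z,I,I,T,M,Z,M,Z], [T,Z,Z,Z,I,Z,Z,T,Z,I,Z,M], [T,Z,Z,Z,I,I,Z,T,I,I,Z,Z],
    [T,Z,Z,I,Z,Z,M,T,Z,M,Z,Z], [T,Z,Z,I,I,Z,Z,T,Z,Z,M,Z], [T,Z,I,Z,Z,Z,Z,T,Z,Z,Z,Z],
    [T,Z,I,Z,Z,Z,Z,T,M,I,Z,I], [T,Z,I,M,Z,Z,Z,T,Z,Z,Z,Z], [T,Z,I,M,Z,Z,M,T,Z,Z,M,M],
    [T,Z,I,I,Z,M,Z,T,Z,Z,I,M], [T,Z,I,I,M,I,I,T,I,Z,Z,Z], [T,I,Z,Z,Z,Z,I,T,M,Z,Z,M],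
    [T,I,Z,Z,Z,M,I,T,Z,Z,Z,Z], [T,I,Z,Z,Z,I,M,T,M,Z,I,Z], [T,I,Z,Z,I,Z,Z,T,I,Z,Z,Z],
    [T,I,Z,M,M,Z,Z,T,I,Z,Z,Z], [T,I,Z,I,M,Z,M,T,Z,I,M,Z], [T,I,M,Z,Z,Z,Z,T,Z,Z,Z,Z],
    [T,I,I,Z,I,Z,Z,T,Z,M,Z,I]],
   [[T,Z,Z,Z,Z,Z,I,M,T,Z,I,Z], [T,Z,Z,Z,Z,I,Z,Z,T,Z,Z,Z], [T,Z,Z,Z,Z,I,Z,I,T,Z,Z,I],
    [T,Z,Z,Z,I,Z,Z,Z,T,Z,Z,Z], [T,Z,Z,Z,I,Z,Z,Z,T,Z,Z,M], [T,Z,Z,Z,I,Z,M,Z,T,I,Z,Z],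
    [T,Z,Z,Z,I,M,Z,Z,T,I,Z,I], [T,Z,Z,I,Z,Z,Z,Z,T,Z,I,M], [T,Z,Z,I,I,Z,I,Z,T,Z,M,M],
    [T,Z,Z,I,M,Z,M,Z,T,I,Z,Z], [T,Z,I,Z,Z,Z,Z,M,T,Z,Z,Z], [T,Z,I,Z,I,Z,Z,Z,T,M,I,I],
    [T,Z,I,Z,M,M,I,Z,T,Z,Z,Z], [T,Z,I,I,Z,Z,M,M,T,Z,Z,Z], [T,I,Z,Z,Z,I,I,Z,T,I,Z,Z],
    [T,I,Z,I,Z,Z,Z,I,T,Z,I,Z], [T,I,Z,M,Z,Z,Z,M,T,I,Z,Z], [T,I,Z,M,Z,Z,M,Z,T,M,Z,M],
    [T,I,I,Z,Z,I,Z,Z,T,Z,Z,Z], [T,I,M,Z,Z,M,Z,Z,T,Z,I,Z], [T,I,I,Z,Z,M,Z,I,T,Z,M,Z],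
    [T,I,M,I,Z,Z,Z,M,T,M,M,I]],
   [[T,Z,Z,Z,Z,Z,I,Z,Z,T,I,M], [T,Z,Z,Z,Z,Z,I,Z,M,T,Z,Z], [T,Z,Z,Z,Z,I,Z,I,M,T,M,Z],
    [T,Z,Z,Z,I,Z,I,Z,Z,T,Z,I], [T,Z,Z,Z,I,I,Z,M,M,T,Z,Z], [T,Z,Z,I,Z,Z,Z,M,Z,T,I,Z],
    [T,Z,Z,I,Z,I,Z,I,Z,T,I,Z], [T,Z,Z,I,I,Z,Z,Z,Z,T,Z,I], [T,Z,I,Z,Z,Z,Z,M,I,T,M,Z],
    [T,Z,I,Z,M,Z,Z,Z,M,T,Z,I], [T,Z,I,Z,I,M,M,I,Z,T,Z,Z], [T,Z,I,M,Z,Z,Z,Z,Z,T,I,I],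
    [T,Z,I,I,Z,I,Z,Z,I,T,Z,Z], [T,Z,I,M,I,I,Z,Z,Z,T,Z,M], [T,I,Z,Z,Z,Z,Z,Z,Z,T,Z,I],
    [T,I,Z,Z,Z,Z,Z,M,Z,T,Z,Z], [T,I,Z,Z,Z,Z,I,Z,Z,T,M,Z], [T,I,Z,Z,Z,Z,I,I,I,T,Z,Z],
    [T,I,Z,Z,M,I,M,Z,Z,T,Z,Z], [T,I,Z,M,Z,Z,Z,Z,Z,T,I,Z], [T,I,M,Z,I,Z,M,Z,Z,T,Z,Z],
    [T,I,I,I,Z,M,Z,Z,M,T,Z,M]],
   [[T,Z,Z,Z,Z,Z,Z,Z,Z,I,T,M], [T,Z,Z,Z,Z,I,Z,Z,M,Z,T,Z], [T,Z,Z,Z,I,Z,Z,M,M,I,T,Z],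
    [T,Z,Z,Z,I,Z,I,Z,I,Z,T,Z], [T,Z,Z,Z,I,Z,M,Z,M,M,T,M], [T,Z,Z,Z,I,M,Z,I,Z,Z,T,Z],
    [T,Z,Z,Z,I,I,I,Z,Z,M,T,I], [T,Z,Z,I,Z,Z,Z,M,Z,Z,T,Z], [T,Z,Z,I,Z,Z,Z,I,Z,Z,T,I],
    [T,Z,Z,I,Z,Z,Z,M,Z,M,T,Z], [T,Z,I,Z,Z,Z,Z,M,I,Z,T,Z], [T,Z,I,Z,Z,I,I,Z,Z,Z,T,M],
    [T,Z,I,Z,M,Z,Z,Z,Z,Z,T,Z], [T,Z,I,I,Z,Z,Z,Z,M,I,T,I], [T,I,Z,Z,I,I,M,Z,I,I,T,Z],
    [T,I,Z,M,Z,Z,I,Z,M,Z,T,Z], [T,I,Z,M,Z,M,Z,M,Z,Z,T,I], [T,I,Z,I,Z,M,I,Z,Z,Z,T,M],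
    [T,I,I,Z,Z,Z,Z,I,Z,Z,T,Z], [T,I,I,Z,Z,Z,M,Z,Z,M,T,Z], [T,I,M,Z,M,I,Z,Z,Z,Z,T,Z],
    [T,I,M,I,Z,Z,Z,Z,Z,Z,T,Z]],
   [[T,Z,Z,Z,Z,Z,I,I,I,Z,Z,T], [T,Z,Z,Z,I,Z,Z,I,Z,I,M,T], [T,Z,Z,Z,I,M,Z,M,Z,M,Z,T],
    [T,Z,Z,Z,I,M,I,Z,Z,Z,I,T], [T,Z,Z,Z,I,I,M,Z,I,Z,Z,T], [T,Z,Z,I,Z,Z,Z,Z,Z,Z,Z,T],
    [T,Z,Z,I,Z,I,I,Z,Z,M,Z,T], [T,Z,Z,I,Z,M,M,I,M,Z,Z,T], [T,Z,Z,I,I,Z,Z,Z,Z,Z,Z,T],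
    [T,Z,Z,I,M,Z,Z,M,Z,Z,M,T], [T,Z,I,Z,Z,Z,Z,Z,Z,Z,I,T], [T,Z,I,Z,Z,Z,M,Z,Z,Z,I,T],
    [T,Z,I,Z,Z,I,Z,I,Z,M,Z,T], [T,Z,I,M,Z,Z,Z,Z,M,Z,M,T], [T,I,Z,Z,Z,Z,M,Z,Z,M,Z,T],
    [T,I,Z,Z,I,Z,Z,Z,Z,Z,M,T], [T,I,Z,Z,M,M,Z,I,I,Z,Z,T], [T,I,Z,I,Z,Z,Z,Z,Z,Z,Z,T],
    [T,I,I,Z,Z,Z,Z,M,I,I,Z,T], [T,I,I,Z,Z,Z,I,Z,M,Z,Z,T], [T,I,M,Z,Z,I,Z,Z,M,I,I,T],
    [T,I,M,M,Z,Z,Z,Z,Z,M,Z,T]],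
   [[T,Z,Z,Z,Z,Z,I,Z,Z,Z,Z,M], [T,Z,Z,Z,Z,Z,I,Z,Z,M,M,M], [T,Z,Z,Z,Z,Z,I,Z,M,I,I,Z],
    [T,Z,Z,Z,I,Z,Z,Z,I,I,Z,Z], [T,Z,Z,Z,I,Z,Z,I,M,Z,Z,M], [T,Z,Z,Z,I,I,M,M,M,Z,M,Z],
    [T,Z,Z,I,Z,Z,I,Z,Z,Z,Z,Z], [T,Z,Z,I,Z,M,Z,Z,M,Z,M,Z], [T,Z,Z,I,M,Z,M,Z,Z,Z,Z,Z],
    [T,Z,Z,I,M,I,Z,I,Z,Z,Z,Z], [T,Z,I,Z,Z,M,Z,Z,Z,Z,Z,I], [T,Z,I,Z,Z,M,Z,Z,Z,M,Z,Z],
    [T,Z,I,M,Z,I,Z,I,Z,Z,Z,Z], [T,Z,I,M,M,Z,Z,Z,M,Z,Z,Z], [T,I,Z,Z,Z,Z,Z,I,I,Z,M,Z],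
    [T,I,Z,Z,Z,Z,M,Z,Z,M,I,M], [T,I,Z,Z,Z,I,I,M,Z,M,Z,I], [T,I,Z,Z,M,Z,Z,M,Z,I,Z,M],
    [T,I,I,Z,Z,Z,Z,Z,Z,I,M,Z], [T,I,M,Z,Z,Z,Z,I,M,Z,Z,I], [T,I,M,M,Z,M,Z,Z,Z,Z,Z,Z],
    [T,I,I,I,I,Z,Z,Z,Z,Z,I,Z]],
   [[T,Z,Z,Z,Z,Z,Z,Z,I,Z,Z,M], [T,Z,Z,Z,Z,Z,Z,I,I,I,I,I], [T,Z,Z,Z,Z,Z,I,Z,Z,Z,I,Z],
    [T,Z,Z,Z,I,Z,Z,Z,Z,M,I,Z], [T,Z,Z,Z,I,I,Z,Z,Z,Z,M,Z], [T,Z,Z,Z,I,M,M,Z,Z,Z,Z,Z],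
    [T,Z,Z,I,Z,Z,Z,Z,Z,Z,I,Z], [T,Z,Z,I,Z,M,Z,Z,Z,M,M,Z], [T,Z,Z,I,Z,I,Z,I,Z,Z,Z,Z],
    [T,Z,Z,I,Z,M,Z,M,I,Z,Z,I], [T,Z,I,Z,M,Z,Z,I,Z,Z,M,I], [T,Z,I,Z,M,Z,M,Z,M,M,I,Z],
    [T,Z,I,M,Z,M,Z,Z,Z,I,Z,M], [T,Z,I,M,I,Z,I,Z,Z,M,Z,I], [T,I,Z,Z,Z,Z,Z,M,M,I,Z,I],
    [T,I,Z,Z,Z,Z,I,Z,Z,Z,Z,Z], [T,I,Z,Z,Z,M,Z,I,Z,Z,Z,Z], [T,I,Z,Z,I,Z,M,I,Z,Z,Z,Z],
    [T,I,M,Z,Z,Z,Z,Z,M,Z,Z,Z], [T,I,I,Z,Z,I,M,M,I,Z,Z,Z], [T,I,I,I,Z,Z,I,Z,Z,Z,Z,M],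
    [T,I,M,M,M,Z,Z,Z,I,M,Z,Z]],
   [[T,Z,Z,Z,Z,Z,Z,Z,I,M,Z,I], [T,Z,Z,Z,Z,Z,Z,I,M,I,Z,Z], [T,Z,Z,Z,Z,I,Z,Z,M,Z,Z,I],
    [T,Z,Z,Z,Z,I,Z,I,I,I,M,Z], [T,Z,Z,Z,Z,I,I,I,Z,M,Z,Z], [T,Z,Z,Z,I,Z,Z,I,Z,Z,Z,Z],
    [T,Z,Z,Z,I,M,Z,Z,Z,Z,Z,I], [T,Z,Z,I,Z,Z,Z,Z,Z,M,I,M], [T,Z,Z,I,Z,Z,I,Z,I,Z,Z,I],
    [T,Z,Z,I,I,Z,Z,Z,M,Z,Z,I], [T,Z,I,Z,Z,I,I,M,Z,Z,Z,Z], [T,Z,I,I,Z,Z,Z,M,Z,I,Z,Z],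
    [T,Z,I,M,Z,M,I,Z,Z,Z,M,Z], [T,Z,I,M,I,Z,Z,Z,Z,Z,I,Z], [T,I,Z,Z,Z,Z,Z,Z,M,M,M,Z],
    [T,I,Z,Z,I,Z,I,Z,Z,Z,Z,M], [T,I,Z,Z,I,Z,M,Z,I,Z,Z,Z], [T,I,Z,M,M,Z,Z,Z,Z,Z,I,I],
    [T,I,M,Z,Z,Z,Z,M,Z,Z,M,Z], [T,I,M,Z,Z,Z,I,Z,Z,I,I,Z], [T,I,I,Z,Z,I,M,Z,Z,Z,Z,Z],
    [T,I,I,I,M,M,Z,I,Z,Z,Z,Z]],
   [[T,Z,Z,Z,Z,Z,Z,Z,Z,Z,I,Z], [T,Z,Z,Z,Z,Z,Z,Z,Z,I,Z,Z], [T,Z,Z,Z,Z,Z,Z,Z,I,I,Z,Z],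
    [T,Z,Z,Z,Z,I,I,Z,I,M,Z,Z], [T,Z,Z,Z,I,Z,Z,M,Z,M,Z,M], [T,Z,Z,I,Z,Z,Z,Z,M,Z,Z,I],
    [T,Z,Z,I,Z,Z,M,Z,M,M,Z,Z], [T,Z,Z,I,I,M,Z,Z,Z,I,Z,Z], [T,Z,I,Z,Z,Z,Z,Z,Z,Z,Z,I],
    [T,Z,I,Z,Z,Z,M,M,I,Z,M,I], [T,Z,I,Z,I,Z,Z,Z,Z,Z,M,M], [T,Z,I,Z,M,M,Z,Z,Z,M,Z,Z],
    [T,Z,I,Z,M,I,Z,M,M,I,Z,M], [T,Z,I,M,I,Z,M,I,Z,Z,I,Z], [T,I,Z,Z,Z,M,Z,Z,Z,Z,Z,M],
    [T,I,Z,Z,Z,I,Z,I,Z,Z,M,Z], [T,I,Z,Z,Z,I,M,Z,Z,Z,I,Z], [T,I,Z,I,Z,Z,Z,M,I,Z,I,Z],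
    [T,I,Z,M,I,Z,I,M,M,Z,Z,I], [T,I,Z,M,M,M,Z,Z,Z,Z,Z,Z], [T,I,M,Z,Z,Z,M,Z,Z,Z,M,Z],
    [T,I,I,I,Z,Z,I,I,Z,Z,Z,Z]],
   [[T,Z,Z,Z,Z,Z,I,Z,M,Z,M,Z], [T,Z,Z,Z,Z,Z,I,M,I,M,Z,I], [T,Z,Z,Z,Z,I,M,Z,Z,M,Z,Z],
    [T,Z,Z,Z,I,Z,I,Z,Z,Z,Z,Z], [T,Z,Z,I,Z,Z,Z,Z,I,Z,Z,Z], [T,Z,Z,I,Z,Z,Z,M,I,Z,M,M],
    [T,Z,Z,I,Z,Z,I,Z,Z,Z,I,Z], [T,Z,Z,I,Z,M,Z,Z,Z,Z,I,Z], [T,Z,Z,I,Z,I,Z,I,Z,I,Z,I],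
    [T,Z,Z,I,I,I,Z,Z,M,M,Z,Z], [T,Z,I,Z,Z,Z,Z,Z,Z,M,Z,M], [T,Z,I,Z,Z,I,I,Z,Z,I,Z,M],
    [T,Z,I,Z,M,Z,Z,I,I,Z,Z,Z], [T,Z,I,Z,I,M,Z,Z,Z,Z,Z,I], [T,I,Z,Z,Z,Z,Z,Z,Z,Z,I,Z],
    [T,I,Z,Z,M,I,Z,M,Z,Z,Z,I], [T,I,Z,M,Z,Z,I,Z,Z,Z,Z,Z], [T,I,Z,I,M,M,Z,Z,M,Z,M,Z],
    [T,I,M,Z,Z,Z,Z,Z,Z,Z,I,M], [T,I,I,Z,Z,Z,Z,I,Z,M,Z,Z], [T,I,M,Z,I,Z,Z,I,I,Z,M,Z],
    [T,I,I,Z,I,Z,M,M,Z,I,Z,Z]],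
   [[T,Z,Z,Z,Z,Z,Z,I,Z,M,I,I], [T,Z,Z,Z,Z,Z,Z,I,I,Z,Z,Z], [T,Z,Z,Z,Z,Z,I,Z,Z,M,Z,M],
    [T,Z,Z,Z,Z,I,Z,Z,I,Z,M,I], [T,Z,Z,Z,I,Z,I,I,Z,Z,Z,I], [T,Z,Z,I,Z,Z,Z,M,Z,M,M,Z],
    [T,Z,Z,I,Z,I,M,Z,Z,Z,I,Z], [T,Z,Z,I,Z,M,I,Z,I,Z,Z,Z], [T,Z,I,Z,Z,I,Z,Z,I,Z,I,M],
    [T,Z,I,Z,Z,M,Z,Z,I,I,Z,Z], [T,Z,I,Z,M,Z,Z,Z,Z,Z,Z,I], [T,Z,I,Z,I,Z,Z,Z,M,I,Z,Z],
    [T,Z,I,Z,I,I,Z,Z,Z,Z,M,Z], [T,Z,I,I,Z,Z,Z,Z,Z,M,Z,Z], [T,I,Z,Z,Z,Z,Z,M,Z,Z,Z,I],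
    [T,I,Z,Z,Z,Z,Z,I,Z,Z,M,M], [T,I,Z,Z,I,Z,I,M,Z,Z,I,Z], [T,I,Z,I,Z,Z,Z,I,M,Z,Z,Z],
    [T,I,Z,I,M,Z,Z,Z,Z,I,Z,Z], [T,I,Z,M,M,I,I,Z,Z,Z,Z,Z], [T,I,M,Z,I,Z,M,Z,I,Z,Z,Z],
    [T,I,I,M,Z,M,M,Z,Z,M,Z,Z]],
   [[T,Z,Z,Z,Z,I,Z,I,Z,Z,Z,Z], [T,Z,Z,Z,Z,I,I,M,Z,Z,Z,Z], [T,Z,Z,Z,Z,I,M,M,I,Z,Z,I],
    [T,Z,Z,Z,I,Z,Z,Z,Z,Z,I,Z], [T,Z,Z,Z,I,Z,I,Z,M,Z,M,I], [T,Z,Z,I,M,Z,Z,Z,Z,I,Z,Z],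
    [T,Z,Z,I,I,Z,Z,Z,I,Z,M,Z], [T,Z,Z,I,M,M,I,M,Z,M,Z,Z], [T,Z,I,Z,Z,Z,Z,Z,M,I,M,M],
    [T,Z,I,Z,Z,Z,I,Z,I,Z,Z,Z], [T,Z,I,Z,Z,I,Z,M,Z,Z,Z,M], [T,Z,I,Z,Z,M,Z,I,I,Z,Z,Z],
    [T,Z,I,Z,I,Z,Z,Z,Z,M,Z,Z], [T,Z,I,I,Z,Z,M,Z,Z,Z,Z,Z], [T,I,Z,Z,Z,Z,Z,Z,Z,Z,M,I],
    [T,I,Z,Z,Z,Z,Z,Z,Z,I,Z,Z], [T,I,Z,Z,I,M,Z,M,Z,I,I,Z], [T,I,Z,M,Z,Z,Z,Z,Z,M,Z,M],
    [T,I,Z,I,Z,Z,M,Z,M,M,Z,Z], [T,I,Z,I,Z,I,I,I,Z,Z,I,Z], [T,I,M,Z,Z,Z,Z,Z,I,Z,M,M],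
    [T,I,I,M,M,Z,Z,Z,Z,Z,Z,I]],
   [[T,Z,Z,Z,Z,Z,I,M,I,Z,I,Z], [T,Z,Z,Z,Z,I,Z,Z,Z,M,Z,I], [T,Z,Z,Z,Z,I,Z,Z,I,I,Z,I],
    [T,Z,Z,Z,Z,I,M,Z,Z,Z,I,M], [T,Z,Z,Z,I,Z,Z,Z,I,M,I,Z], [T,Z,Z,Z,I,Z,M,M,Z,Z,M,Z],
    [T,Z,Z,Z,I,M,M,Z,Z,I,I,Z], [T,Z,Z,I,M,Z,Z,I,I,Z,Z,Z], [T,Z,Z,I,M,Z,M,M,Z,Z,Z,Z],
    [T,Z,Z,I,I,I,Z,Z,Z,Z,M,Z], [T,Z,I,Z,I,Z,Z,I,Z,Z,Z,Z], [T,Z,I,I,Z,Z,Z,I,Z,Z,Z,M],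
    [T,Z,I,M,Z,I,Z,Z,Z,Z,Z,Z], [T,Z,I,M,M,Z,M,Z,Z,Z,Z,Z], [T,I,Z,Z,Z,Z,Z,Z,I,I,Z,Z],
    [T,I,Z,Z,Z,Z,I,Z,M,I,Z,Z], [T,I,Z,Z,Z,I,Z,Z,M,Z,I,Z], [T,I,Z,M,Z,Z,Z,Z,I,Z,M,M],
    [T,I,M,Z,Z,Z,Z,Z,Z,M,Z,M], [T,I,M,Z,Z,Z,M,I,Z,Z,Z,I], [T,I,I,Z,Z,M,Z,Z,Z,M,Z,I],
    [T,I,I,I,Z,Z,Z,M,Z,Z,Z,Z]],
   [[T,Z,Z,Z,Z,Z,Z,I,Z,M,Z,I], [T,Z,Z,Z,Z,Z,I,M,Z,Z,Z,M], [T,Z,Z,Z,Z,I,Z,I,Z,Z,M,Z],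
    [T,Z,Z,Z,Z,I,Z,M,M,Z,Z,I], [T,Z,Z,I,Z,Z,I,Z,Z,I,M,Z], [T,Z,Z,I,Z,M,M,Z,Z,Z,Z,M],
    [T,Z,Z,I,I,Z,M,Z,M,Z,M,Z], [T,Z,Z,I,M,M,Z,Z,I,Z,Z,I], [T,Z,I,Z,Z,Z,Z,M,Z,Z,Z,I],
    [T,Z,I,Z,Z,Z,I,Z,Z,Z,Z,Z], [T,Z,I,Z,Z,I,M,Z,I,I,Z,Z], [T,Z,I,Z,I,Z,Z,I,Z,I,I,Z],
    [T,Z,I,I,Z,Z,Z,Z,Z,M,I,Z], [T,Z,I,M,I,M,Z,Z,Z,M,M,Z], [T,I,Z,Z,Z,Z,Z,Z,I,Z,M,Z],
    [T,I,Z,Z,Z,Z,I,I,Z,Z,Z,Z], [T,I,Z,Z,Z,M,Z,Z,M,I,Z,I], [T,I,Z,Z,I,Z,Z,M,I,Z,Z,Z],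
    [T,I,Z,I,Z,I,Z,Z,Z,M,Z,Z], [T,I,Z,M,M,Z,M,Z,Z,Z,Z,Z], [T,I,M,Z,I,Z,Z,Z,Z,Z,I,Z],
    [T,I,I,Z,M,Z,Z,Z,M,Z,Z,M]],
   [[T,Z,Z,Z,Z,Z,I,Z,M,I,Z,M], [T,Z,Z,Z,Z,I,Z,Z,Z,Z,Z,I], [T,Z,Z,Z,I,Z,Z,M,M,Z,I,I],
    [T,Z,Z,Z,I,M,Z,Z,I,Z,M,I], [T,Z,Z,I,Z,M,Z,Z,M,M,Z,Z], [T,Z,Z,I,Z,I,M,I,Z,Z,Z,Z],
    [T,Z,I,Z,Z,Z,I,Z,Z,M,Z,Z], [T,Z,I,Z,Z,M,Z,Z,Z,Z,M,Z], [T,Z,I,Z,Z,M,Z,Z,Z,I,I,Z],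
    [T,Z,I,Z,Z,I,I,Z,Z,Z,M,Z], [T,Z,I,Z,M,Z,Z,Z,I,Z,I,Z], [T,Z,I,Z,I,I,Z,M,Z,Z,Z,Z],
    [T,Z,I,I,Z,Z,M,Z,Z,I,Z,Z], [T,Z,I,M,Z,Z,M,I,M,M,Z,Z], [T,I,Z,Z,Z,Z,Z,Z,I,Z,Z,Z],
    [T,I,Z,Z,Z,Z,I,I,Z,Z,I,I], [T,I,Z,Z,M,Z,Z,Z,M,I,M,I], [T,I,Z,Z,I,Z,Z,I,Z,Z,Z,Z],
    [T,I,Z,M,Z,Z,Z,Z,Z,Z,Z,M], [T,I,Z,M,Z,Z,M,M,Z,Z,Z,Z], [T,I,Z,I,I,Z,Z,Z,Z,Z,Z,M],
    [T,I,Z,I,M,Z,Z,M,Z,M,Z,Z]],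
   [[T,Z,Z,Z,Z,Z,Z,I,I,Z,I,Z], [T,Z,Z,Z,I,Z,Z,Z,Z,I,Z,Z], [T,Z,Z,Z,I,Z,I,Z,Z,M,I,Z],
    [T,Z,Z,Z,I,I,Z,Z,Z,M,M,M], [T,Z,Z,I,Z,I,M,Z,M,M,I,I], [T,Z,Z,I,M,Z,Z,I,Z,Z,Z,Z],
    [T,Z,I,Z,Z,Z,I,M,Z,Z,Z,Z], [T,Z,I,Z,Z,Z,I,I,M,Z,Z,Z], [T,Z,I,Z,Z,M,Z,Z,M,Z,Z,Z],
    [T,Z,I,Z,I,Z,M,Z,Z,Z,Z,Z], [T,Z,I,I,Z,Z,Z,I,I,Z,Z,M], [T,Z,I,M,Z,Z,M,Z,I,Z,Z,I],
    [T,Z,I,I,Z,I,Z,M,Z,I,Z,Z], [T,Z,I,M,M,Z,Z,Z,Z,M,Z,Z], [T,I,Z,Z,Z,Z,Z,Z,Z,Z,Z,Z],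
    [T,I,Z,Z,Z,Z,Z,Z,Z,M,M,Z], [T,I,Z,Z,Z,Z,M,Z,Z,Z,Z,M], [T,I,Z,Z,Z,I,I,Z,I,Z,Z,I],
    [T,I,Z,Z,M,Z,Z,M,Z,Z,I,M], [T,I,Z,Z,I,M,Z,Z,Z,Z,I,Z], [T,I,Z,I,Z,M,Z,Z,Z,Z,M,I],
    [T,I,Z,M,Z,I,Z,I,M,I,Z,Z]],
   [[T,Z,Z,Z,Z,Z,Z,I,Z,M,Z,Z], [T,Z,Z,Z,I,Z,Z,Z,Z,Z,I,I], [T,Z,Z,Z,I,Z,M,M,Z,I,Z,Z],
    [T,Z,Z,I,Z,Z,I,Z,M,Z,M,Z], [T,Z,Z,I,Z,I,Z,Z,Z,Z,Z,M], [T,Z,Z,I,I,Z,Z,Z,I,M,Z,I],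
    [T,Z,Z,I,M,Z,Z,I,I,I,I,Z], [T,Z,Z,I,I,M,I,Z,Z,Z,Z,M], [T,Z,I,Z,Z,Z,Z,Z,M,Z,Z,Z],
    [T,Z,I,Z,Z,Z,Z,M,I,M,Z,Z], [T,Z,I,Z,Z,Z,I,Z,I,I,Z,Z], [T,Z,I,Z,Z,M,Z,Z,Z,Z,Z,Z],
    [T,Z,I,Z,Z,I,Z,I,Z,Z,M,I], [T,Z,I,M,I,Z,Z,I,Z,Z,Z,M], [T,I,Z,Z,Z,Z,I,Z,M,Z,I,I],
    [T,I,Z,Z,Z,M,Z,Z,Z,Z,Z,Z], [T,I,Z,Z,Z,I,Z,Z,Z,M,I,M], [T,I,Z,Z,Z,M,M,I,Z,Z,Z,Z],
    [T,I,Z,Z,I,I,Z,Z,Z,I,Z,Z], [T,I,Z,I,Z,Z,M,Z,Z,Z,M,Z], [T,I,I,Z,M,Z,Z,M,Z,Z,Z,Z],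
    [T,I,M,M,Z,Z,I,Z,I,Z,M,Z]]]"

definition base_words :: "digit list list" where
  "base_words =
   [[I,Z,Z,Z,Z,Z,Z,Z,Z,Z,Z,Z], [I,Z,Z,Z,Z,Z,Z,Z,Z,Z,Z,I], [I,Z,Z,Z,Z,Z,Z,Z,Z,Z,I,Z],
    [I,Z,Z,Z,Z,Z,Z,Z,Z,Z,I,M], [I,Z,Z,Z,Z,Z,Z,Z,Z,I,T,Z], [I,Z,Z,Z,Z,Z,Z,Z,Z,I,Z,M],
    [I,Z,Z,Z,Z,Z,Z,Z,Z,I,I,Z], [I,Z,Z,Z,Z,Z,Z,Z,I,Z,T,Z], [I,Z,Z,Z,Z,Z,Z,Z,I,Z,Z,I],
    [I,Z,Z,Z,Z,Z,Z,Z,M,T,M,I], [I,Z,Z,Z,Z,Z,Z,Z,I,I,Z,Z], [I,Z,Z,Z,Z,Z,Z,Z,M,I,I,I],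
    [I,Z,Z,Z,Z,Z,Z,I,Z,Z,T,Z], [I,Z,Z,Z,Z,Z,Z,I,Z,Z,Z,I], [I,Z,Z,Z,Z,Z,Z,I,Z,Z,M,M],
    [I,Z,Z,Z,Z,Z,Z,I,Z,M,Z,Z], [I,Z,Z,Z,Z,Z,Z,I,Z,I,I,Z], [I,Z,Z,Z,Z,Z,Z,I,I,Z,T,Z],
    [I,Z,Z,Z,Z,Z,Z,I,I,Z,I,Z], [I,Z,Z,Z,Z,Z,Z,I,I,M,Z,Z], [I,Z,Z,Z,Z,Z,I,T,Z,Z,Z,Z],
    [I,Z,Z,Z,Z,Z,I,Z,Z,Z,Z,I], [I,Z,Z,Z,Z,Z,I,Z,Z,Z,I,T], [I,Z,Z,Z,Z,Z,I,Z,Z,M,T,M],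
    [I,Z,Z,Z,Z,Z,I,Z,Z,I,I,Z], [I,Z,Z,Z,Z,Z,M,Z,I,Z,Z,Z], [I,Z,Z,Z,Z,Z,I,Z,I,Z,I,M],
    [I,Z,Z,Z,Z,Z,I,Z,I,I,Z,T], [I,Z,Z,Z,Z,Z,I,Z,M,I,M,Z], [I,Z,Z,Z,Z,Z,I,I,Z,Z,Z,I],
    [I,Z,Z,Z,Z,Z,I,I,Z,Z,M,Z], [I,Z,Z,Z,Z,Z,I,I,Z,I,Z,Z], [I,Z,Z,Z,Z,Z,I,I,M,Z,Z,I],
    [I,Z,Z,Z,Z,I,Z,Z,Z,Z,T,Z], [I,Z,Z,Z,Z,I,Z,Z,Z,Z,Z,I], [I,Z,Z,Z,Z,I,Z,Z,T,T,I,Z],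
    [I,Z,Z,Z,Z,I,Z,Z,Z,I,Z,Z], [I,Z,Z,Z,Z,I,Z,Z,Z,I,I,Z], [I,Z,Z,Z,Z,I,Z,Z,I,Z,Z,Z],
    [I,Z,Z,Z,Z,I,Z,Z,I,T,M,Z], [I,Z,Z,Z,Z,I,Z,Z,I,I,Z,I], [I,Z,Z,Z,Z,I,Z,I,Z,Z,Z,M],
    [I,Z,Z,Z,Z,I,Z,I,T,Z,M,T], [I,Z,Z,Z,Z,I,Z,I,Z,M,Z,M], [I,Z,Z,Z,Z,I,Z,I,M,Z,Z,Z],
    [I,Z,Z,Z,Z,I,I,Z,Z,Z,T,Z], [I,Z,Z,Z,Z,I,I,Z,Z,Z,M,I], [I,Z,Z,Z,Z,I,I,Z,Z,I,T,I],
    [I,Z,Z,Z,Z,I,I,Z,I,Z,Z,Z], [I,Z,Z,Z,Z,I,I,I,T,Z,T,Z], [I,Z,Z,Z,Z,I,I,M,Z,Z,M,Z],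
    [I,Z,Z,Z,Z,I,M,I,I,M,Z,Z], [I,Z,Z,Z,I,Z,Z,Z,Z,T,Z,Z], [I,Z,Z,Z,I,Z,Z,Z,Z,Z,Z,I],
    [I,Z,Z,Z,I,Z,Z,Z,Z,Z,I,I], [I,Z,Z,Z,I,Z,Z,Z,Z,I,Z,M], [I,Z,Z,Z,I,Z,Z,Z,Z,M,M,Z],
    [I,Z,Z,Z,I,Z,T,Z,M,Z,Z,Z], [I,Z,Z,Z,I,Z,Z,Z,I,T,M,Z], [I,Z,Z,Z,I,Z,Z,Z,I,M,Z,M],
    [I,Z,Z,Z,I,Z,Z,M,Z,Z,Z,Z], [I,Z,Z,Z,I,Z,Z,M,Z,Z,M,Z], [I,Z,Z,Z,I,Z,Z,M,Z,I,T,Z],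
    [I,Z,Z,Z,I,Z,T,M,M,Z,Z,M], [I,Z,Z,Z,I,Z,Z,I,I,Z,M,Z], [I,Z,Z,Z,I,Z,I,Z,Z,Z,Z,Z],
    [I,Z,Z,Z,I,Z,I,Z,Z,Z,M,Z], [I,Z,Z,Z,I,Z,I,Z,Z,I,Z,Z], [I,Z,Z,Z,I,Z,I,Z,I,Z,Z,Z],
    [I,Z,Z,Z,I,Z,I,I,Z,T,Z,Z], [I,Z,Z,Z,I,Z,I,I,Z,I,I,I], [I,Z,Z,Z,I,I,Z,Z,Z,Z,Z,T],
    [I,Z,Z,Z,I,I,Z,Z,T,Z,I,M], [I,Z,Z,Z,I,I,T,Z,Z,M,Z,Z], [I,Z,Z,Z,I,I,Z,T,I,Z,T,Z],
    [I,Z,Z,Z,I,I,T,Z,M,I,M,Z], [I,Z,Z,Z,I,I,Z,I,Z,Z,T,I], [I,Z,Z,Z,I,I,Z,M,Z,I,Z,T],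
    [I,Z,Z,Z,I,I,I,Z,Z,Z,Z,Z], [I,Z,Z,Z,I,I,I,Z,I,Z,Z,I], [I,Z,Z,I,Z,Z,Z,Z,T,Z,Z,Z],
    [I,Z,Z,I,Z,Z,Z,Z,Z,Z,Z,I], [I,Z,Z,I,Z,Z,Z,Z,Z,Z,M,T], [I,Z,Z,I,Z,Z,Z,Z,Z,M,Z,Z],
    [I,Z,Z,I,Z,Z,Z,Z,Z,M,I,I], [I,Z,Z,I,Z,Z,Z,Z,I,Z,Z,Z], [I,Z,Z,I,Z,Z,T,Z,M,T,M,Z],
    [I,Z,Z,I,Z,Z,Z,Z,I,I,Z,Z], [I,Z,Z,I,Z,Z,Z,I,T,Z,Z,Z], [I,Z,Z,I,Z,Z,Z,M,Z,Z,I,M],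
    [I,Z,Z,I,Z,Z,Z,I,Z,I,Z,Z], [I,Z,Z,I,Z,Z,Z,I,M,Z,Z,Z], [I,Z,Z,I,Z,Z,Z,I,I,I,Z,I],
    [I,Z,Z,I,Z,Z,I,Z,Z,Z,Z,Z], [I,Z,Z,I,Z,Z,I,T,Z,Z,M,T], [I,Z,Z,I,Z,Z,M,Z,Z,I,Z,I],
    [I,Z,Z,I,Z,Z,I,Z,I,T,Z,M], [I,Z,Z,I,Z,Z,I,M,T,Z,Z,Z], [I,Z,Z,I,Z,Z,M,I,M,Z,M,Z],
    [I,Z,Z,I,Z,I,Z,Z,Z,Z,T,M], [I,Z,Z,I,Z,M,Z,Z,Z,Z,I,M], [I,Z,Z,I,Z,I,Z,Z,Z,I,Z,Z],
    [I,Z,Z,I,Z,I,Z,Z,M,T,Z,I], [I,Z,Z,I,Z,I,Z,T,M,Z,M,Z], [I,Z,Z,I,Z,I,Z,M,Z,T,Z,T],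
    [I,Z,Z,I,Z,I,T,M,Z,M,I,Z], [I,Z,Z,I,Z,I,M,T,Z,Z,Z,T], [I,Z,Z,I,Z,I,I,T,Z,I,Z,Z],
    [I,Z,Z,I,I,Z,Z,Z,T,T,Z,M], [I,Z,Z,I,M,Z,Z,Z,Z,Z,M,Z], [I,Z,Z,I,I,Z,Z,Z,T,M,Z,Z],
    [I,Z,Z,I,I,Z,Z,Z,T,I,I,Z], [I,Z,Z,I,I,Z,Z,Z,I,Z,T,Z], [I,Z,Z,I,I,Z,Z,I,Z,T,Z,M],
    [I,Z,Z,I,I,Z,I,Z,Z,Z,Z,I], [I,Z,Z,I,I,Z,M,T,I,M,Z,Z], [I,Z,Z,I,I,Z,M,I,Z,Z,Z,Z],
    [I,Z,Z,I,I,I,Z,Z,Z,Z,Z,Z], [I,Z,Z,I,I,I,Z,M,M,Z,Z,Z], [I,Z,Z,I,I,I,M,Z,Z,Z,I,T],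
    [I,Z,I,Z,Z,Z,Z,Z,Z,Z,T,T], [I,Z,I,Z,Z,Z,Z,Z,Z,Z,Z,M], [I,Z,I,Z,Z,Z,Z,Z,Z,Z,I,Z],
    [I,Z,I,Z,Z,Z,Z,Z,Z,M,Z,T], [I,Z,I,Z,Z,Z,Z,Z,T,M,I,Z], [I,Z,I,Z,Z,Z,Z,Z,M,T,Z,M],
    [I,Z,I,Z,Z,Z,Z,Z,I,Z,I,T], [I,Z,I,Z,Z,Z,Z,Z,I,I,Z,Z], [I,Z,I,Z,Z,Z,Z,I,Z,Z,Z,Z],
    [I,Z,I,Z,Z,Z,Z,I,Z,Z,I,I], [I,Z,I,Z,Z,T,T,M,Z,I,Z,M], [I,Z,I,Z,Z,Z,Z,I,M,Z,Z,M],
    [I,Z,I,Z,Z,Z,Z,I,M,M,M,Z], [I,Z,I,Z,Z,Z,I,Z,Z,Z,Z,M], [I,Z,I,Z,Z,Z,M,Z,T,Z,M,I],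
    [I,Z,I,Z,Z,Z,I,T,Z,I,T,Z], [I,Z,I,Z,Z,Z,I,Z,I,Z,Z,Z], [I,Z,I,Z,Z,Z,I,M,Z,Z,T,Z],
    [I,Z,I,Z,Z,Z,I,I,Z,M,Z,T], [I,Z,I,Z,Z,I,Z,Z,Z,T,Z,Z], [I,Z,I,Z,Z,I,Z,Z,Z,Z,I,Z],
    [I,Z,I,Z,Z,I,Z,Z,Z,I,Z,Z], [I,Z,I,Z,Z,I,Z,Z,Z,I,I,I], [I,Z,I,Z,Z,I,Z,Z,M,Z,Z,I],
    [I,Z,I,Z,Z,I,Z,I,Z,Z,Z,Z], [I,Z,I,Z,Z,I,Z,I,I,T,Z,Z], [I,Z,I,Z,Z,I,M,Z,Z,Z,Z,Z],
    [I,Z,I,Z,Z,I,M,Z,I,Z,M,Z], [I,Z,I,Z,I,Z,Z,Z,T,Z,Z,Z], [I,Z,I,Z,I,Z,Z,Z,Z,Z,I,Z],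
    [I,Z,I,Z,I,Z,Z,T,T,M,Z,M], [I,Z,I,Z,I,Z,Z,Z,M,Z,T,Z], [I,Z,I,Z,I,T,Z,Z,M,M,Z,Z],
    [I,Z,I,Z,I,Z,Z,I,Z,Z,Z,Z], [I,Z,I,Z,I,Z,I,Z,T,Z,Z,I], [I,Z,I,Z,I,Z,M,Z,Z,Z,I,Z],
    [I,Z,I,Z,I,Z,M,M,M,Z,Z,Z], [I,Z,I,Z,I,I,Z,Z,Z,Z,Z,M], [I,Z,I,Z,I,I,Z,I,Z,Z,M,T],
    [I,Z,I,Z,I,I,I,Z,Z,I,T,Z], [I,Z,I,I,Z,Z,Z,Z,Z,Z,T,M], [I,Z,I,I,Z,Z,Z,Z,Z,Z,I,Z],
    [I,Z,I,I,Z,Z,Z,Z,Z,I,Z,M], [I,Z,I,I,Z,Z,Z,Z,M,T,Z,Z], [I,Z,I,I,Z,T,Z,I,Z,Z,Z,Z],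
    [I,Z,I,I,Z,Z,Z,M,Z,Z,M,Z], [I,Z,I,I,Z,Z,M,Z,T,Z,Z,T], [I,Z,I,I,Z,Z,I,Z,T,M,M,Z],
    [I,Z,I,I,Z,T,M,Z,M,Z,Z,Z], [I,Z,I,I,Z,I,Z,Z,Z,Z,Z,T], [I,Z,I,I,Z,I,Z,Z,M,I,Z,T],
    [I,Z,I,I,Z,I,I,I,Z,Z,Z,I], [I,Z,I,I,I,Z,Z,Z,Z,Z,Z,Z], [I,Z,I,I,I,Z,Z,Z,I,Z,I,I],
    [I,Z,I,I,I,Z,Z,I,T,I,Z,Z], [I,Z,I,I,I,M,T,Z,Z,Z,Z,Z], [I,I,Z,Z,Z,Z,Z,Z,Z,Z,Z,Z],
    [I,I,Z,Z,Z,Z,Z,Z,Z,Z,Z,M], [I,I,Z,Z,Z,Z,Z,Z,Z,Z,I,Z], [I,I,Z,Z,Z,Z,Z,Z,T,I,Z,M],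
    [I,I,Z,Z,Z,Z,Z,Z,Z,M,I,I], [I,I,Z,Z,Z,Z,Z,Z,M,Z,Z,M], [I,I,Z,Z,Z,Z,Z,Z,I,Z,I,Z],
    [I,I,Z,Z,Z,Z,Z,Z,I,I,Z,Z], [I,I,Z,Z,Z,Z,Z,I,Z,Z,Z,T], [I,I,Z,Z,Z,Z,Z,I,Z,Z,I,Z],
    [I,I,Z,Z,Z,Z,Z,I,Z,I,Z,M], [I,I,Z,Z,Z,Z,Z,I,T,I,I,Z], [I,I,Z,Z,Z,Z,Z,M,I,T,Z,Z],
    [I,I,Z,Z,Z,Z,I,Z,Z,T,T,Z], [I,I,Z,Z,Z,Z,I,Z,Z,Z,I,Z], [I,I,Z,Z,Z,Z,I,Z,Z,M,Z,Z],
    [I,I,Z,Z,Z,Z,I,Z,M,Z,T,Z], [I,I,Z,Z,Z,Z,I,M,Z,Z,Z,M], [I,I,Z,Z,Z,Z,M,I,I,Z,T,T],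
    [I,I,Z,Z,Z,I,Z,Z,Z,Z,Z,I], [I,I,Z,Z,Z,I,Z,Z,T,Z,M,Z], [I,I,Z,Z,Z,I,Z,T,Z,M,Z,Z],
    [I,I,Z,Z,Z,I,Z,T,I,Z,Z,Z], [I,I,Z,Z,Z,M,Z,Z,M,I,Z,Z], [I,I,Z,Z,Z,I,Z,M,Z,Z,T,T],
    [I,I,Z,Z,Z,I,Z,I,I,Z,I,I], [I,I,Z,Z,Z,I,I,Z,Z,T,Z,M], [I,I,Z,Z,Z,I,M,Z,Z,M,M,Z],
    [I,I,Z,Z,I,Z,Z,T,Z,Z,T,Z], [I,I,Z,Z,I,Z,Z,Z,Z,Z,M,I], [I,I,Z,Z,I,T,Z,Z,Z,M,Z,Z],
    [I,I,Z,Z,I,Z,Z,Z,M,Z,Z,M], [I,I,Z,Z,M,Z,Z,I,Z,T,Z,Z], [I,I,Z,Z,I,Z,T,M,M,I,Z,Z],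
    [I,I,Z,Z,I,Z,M,Z,Z,Z,Z,M], [I,I,Z,Z,I,Z,M,Z,Z,M,Z,Z], [I,I,Z,Z,I,Z,I,T,M,Z,M,Z],
    [I,I,Z,Z,I,M,Z,Z,Z,Z,T,Z], [I,I,Z,Z,I,I,Z,Z,Z,T,I,Z], [I,I,Z,Z,I,I,I,M,Z,Z,Z,T],
    [I,I,Z,I,Z,Z,Z,Z,Z,Z,Z,Z], [I,I,Z,I,Z,Z,Z,Z,Z,T,M,Z], [I,I,Z,I,Z,Z,Z,Z,Z,I,Z,T],
    [I,I,Z,I,Z,Z,Z,Z,I,Z,Z,I], [I,I,Z,I,T,Z,Z,Z,M,M,I,Z], [I,I,Z,I,Z,Z,T,I,Z,Z,Z,I],
    [I,I,Z,I,Z,Z,I,Z,Z,Z,Z,Z], [I,I,Z,I,Z,Z,I,Z,Z,Z,I,I], [I,I,Z,I,Z,Z,M,I,Z,I,Z,T],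
    [I,I,Z,I,Z,I,Z,Z,Z,Z,Z,Z], [I,I,Z,I,Z,I,Z,M,Z,Z,Z,Z], [I,I,Z,I,Z,I,I,Z,M,Z,Z,Z],
    [I,I,Z,I,I,Z,Z,Z,Z,Z,Z,Z], [I,I,Z,I,I,T,Z,Z,M,Z,T,Z], [I,I,Z,I,I,Z,Z,M,Z,Z,I,Z],
    [I,I,Z,I,I,I,Z,Z,Z,I,Z,I], [I,I,I,Z,Z,Z,Z,Z,Z,Z,Z,Z], [I,I,I,Z,Z,Z,Z,Z,Z,Z,M,I],
    [I,I,I,Z,Z,Z,Z,Z,Z,I,Z,Z], [I,I,I,Z,Z,Z,Z,Z,I,Z,Z,Z], [I,I,I,Z,Z,Z,Z,Z,I,T,I,Z],
    [I,I,I,Z,Z,Z,Z,I,Z,Z,Z,Z], [I,I,I,Z,Z,Z,M,Z,Z,Z,T,Z], [I,I,I,Z,Z,Z,I,Z,I,I,Z,I],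
    [I,I,I,Z,Z,Z,M,I,Z,T,M,Z], [I,I,I,Z,Z,I,Z,Z,Z,Z,T,M], [I,I,I,Z,Z,I,T,I,Z,I,Z,Z],
    [I,I,I,Z,Z,I,I,Z,Z,Z,T,Z], [I,I,I,Z,M,Z,T,Z,Z,Z,Z,Z], [I,I,I,Z,I,T,Z,Z,Z,M,M,Z],
    [I,I,I,Z,I,Z,Z,I,Z,Z,Z,I], [I,I,I,Z,I,I,Z,Z,M,Z,Z,Z], [I,I,I,I,T,Z,Z,Z,Z,Z,Z,I],
    [I,I,I,I,Z,Z,Z,Z,Z,I,T,Z], [I,I,I,I,T,Z,Z,I,M,Z,Z,Z], [I,I,I,I,Z,M,Z,Z,Z,Z,I,T],
    [I,I,I,I,I,Z,M,Z,Z,Z,Z,T]]"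

definition parities :: "digit list list \<Rightarrow> bool list list" where
  "parities g = map (\<lambda>a. map odd_digit (codeword a)) g"

definition good_word :: "nat \<Rightarrow> digit list \<Rightarrow> bool" where
  "good_word q a \<longleftrightarrow> length a = 12 \<and>
    (let w = codeword a in count_odd w = 8 \<and> count_two w = 2 \<and> w ! 0 = T \<and> w ! q = T)"

definition good_base_word :: "digit list \<Rightarrow> bool" where
  "good_base_word a \<longleftrightarrow> length a = 12 \<and>
    (let w = codeword a in count_odd w = 8 \<and> count_two w = 2 \<and> odd_digit (w ! 0))"

lemma partner_words_good:
  "list_all (\<lambda>(q, g). length g = 22 \<and> list_all (good_word q) g) (List.enumerate 1 partner_words)"
  by code_simp

text \<open>Of 759 octads, 759 * 8 / 24 = 253 contain a given point.\<close>

lemma base_words_good: "length base_words = 253 \<and> list_all good_base_word base_words"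
  by code_simp

text \<open>With \<open>False\<close> before \<open>True\<close>, this strict order certifies that a
  sorted list is distinct by comparing neighbours only, instead of all pairs.\<close>

fun lex_less :: "bool list \<Rightarrow> bool list \<Rightarrow> bool" where
  "lex_less (a # as) (b # bs) = (if a then b \<and> lex_less as bs else b \<or> lex_less as bs)"
| "lex_less _ _ = False"

lemma lex_less_irrefl: "\<not> lex_less x x"
  by (induction x) simp_all

lemma lex_less_trans: "lex_less x y \<Longrightarrow> lex_less y z \<Longrightarrow> lex_less x z"
proof (induction x y arbitrary: z rule: lex_less.induct)
  case (1 a as b bs)
  then show ?case by (cases z) (auto split: if_splits)
qed simp_all

lemma distinct_if_successively_lex_less:
  assumes "successively lex_less xs"
  shows "distinct xs"
proof -
  have "sorted_wrt lex_less xs"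
    using assms by (subst (asm) successively_conv_sorted_wrt) (auto intro: transpI lex_less_trans)
  then show ?thesis
    by (induction xs) (auto simp: lex_less_irrefl)
qed

lemma partner_words_increasing: "list_all (\<lambda>g. successively lex_less (parities g)) partner_words"
  by code_simp

lemma base_words_increasing: "successively lex_less (parities base_words)"
  by code_simp

definition inter :: "bool list \<Rightarrow> bool list \<Rightarrow> nat" where
  "inter x y = length (filter (\<lambda>(a, b). a \<and> b) (zip x y))"

definition pair_count :: "bool list list \<Rightarrow> nat" where
  "pair_count g = sum_list (map (\<lambda>x. length (filter (\<lambda>y. inter x y = 4) g)) g)"

text \<open>The pair counts of the partner words for the coordinates 1 to 23; the entry for 0 is a dummy.\<close>

definition weights :: "int list" where
  "weights = [0, 190, 182, 176, 166, 178, 178, 166, 176, 182, 190, 180, 172, 182, 180, 182, 170, 174, 182, 182, 170, 182, 176, 176]"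

fun weight_sum :: "int list \<Rightarrow> bool list \<Rightarrow> int" where
  "weight_sum (t # ts) (b # bs) = (if b then t + weight_sum ts bs else weight_sum ts bs)"
| "weight_sum _ _ = 0"

definition profile :: "bool list list \<Rightarrow> int" where
  "profile g = sum_list (map (\<lambda>x. (weight_sum weights x)^2) g)"

text \<open>Storing the counts spares their recomputation for the profiles. The tail drops the
  dummy, so the list at index q - 1 belongs to \<open>weights ! q\<close>.\<close>

lemma pair_counts: "map (\<lambda>g. int (pair_count (parities g))) partner_words = tl weights"
  by code_simp

lemma profiles_distinct: "distinct (map (\<lambda>g. profile (parities g)) partner_words)"
  by code_simp

section \<open>Correctness of the certificate\<close>

text \<open>Any numbering of the coordinates will do, so an arbitrary bijection is chosen. Its
  inverse \<open>pt\<close> is meaningful only below 24.\<close>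

definition pos :: "24 \<Rightarrow> nat" where
  "pos = (SOME f. bij_betw f UNIV {..<24})"

definition pt :: "nat \<Rightarrow> 24" where
  "pt = inv pos"

lemma bij_pos: "bij_betw pos UNIV {..<24}"
proof -
  have "\<exists>f :: 24 \<Rightarrow> nat. bij_betw f UNIV {..<24}"
    using ex_bij_betw_finite_nat[of "UNIV :: 24 set"] unfolding card_24 atLeast0LessThan by simp
  then show ?thesis
    unfolding pos_def by (rule someI_ex)
qed

lemma pos_less: "pos i < 24"
  using bij_pos by (auto simp: bij_betw_def)

lemma pt_pos [simp]: "pt (pos i) = i"
  using bij_pos by (simp add: pt_def bij_betw_def)

lemma pos_pt [simp]: "k < 24 \<Longrightarrow> pos (pt k) = k"
  using bij_pos unfolding pt_def by (simp add: bij_betw_def f_inv_into_f)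

lemma sum_pos: "(\<Sum>i\<in>UNIV. f (pos i)) = (\<Sum>k<24. f k)"
  using bij_pos by (rule sum.reindex_bij_betw)

lemma card_pos: "card {i. P (pos i)} = card {k. k < 24 \<and> P k}"
proof -
  have "pos ` {i. P (pos i)} = {k. k < 24 \<and> P k}"
    using bij_pos by (auto simp: bij_betw_def set_eq_iff image_iff) metis
  moreover have "inj_on pos {i. P (pos i)}"
    using bij_pos by (auto simp: bij_betw_def intro: inj_on_subset)
  ultimately show ?thesis by (metis card_image)
qed

section \<open>Lists of digits as words over the integers modulo 4\<close>

lemma val_dadd: "val (dadd x y) = val x + val y"
  by (cases x; cases y) simp_all

lemma val_dmul: "val (dmul x y) = val x * val y"
  by (cases x; cases y) simp_all

lemma odd_digit_iff: "odd_digit d \<longleftrightarrow> 2 * val d \<noteq> 0"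
  by (cases d) (simp_all add: odd_digit_def)

lemma T_iff: "d = T \<longleftrightarrow> val d = 2"
  by (cases d) simp_all

lemma length_vadd [simp]: "length (vadd xs ys) = min (length xs) (length ys)"
  by (induction xs ys rule: vadd.induct) simp_all

lemma vadd_nth: "k < length xs \<Longrightarrow> k < length ys \<Longrightarrow> vadd xs ys ! k = dadd (xs ! k) (ys ! k)"
  by (induction xs ys arbitrary: k rule: vadd.induct) (auto simp: nth_Cons split: nat.split)

lemma val_dot: "length xs = length ys \<Longrightarrow> val (dot xs ys) = (\<Sum>k<length xs. val (xs ! k) * val (ys ! k))"
proof (induction xs ys rule: dot.induct)
  case (1 x xs y ys)
  then show ?case
    by (simp add: val_dadd val_dmul sum.lessThan_Suc_shift del: sum.lessThan_Suc)
qed simp_all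

lemma combine_correct:
  assumes "length as \<le> length rs" "list_all (\<lambda>r. length r = n) rs" "length acc = n"
  shows "length (combine as rs acc) = n \<and>
    (\<forall>j<n. val (combine as rs acc ! j) = (\<Sum>k<length as. val (as ! k) * val (rs ! k ! j)) + val (acc ! j))"
  using assms
proof (induction as rs acc rule: combine.induct)
  case (1 a as r rs acc)
  have "val (combine (a # as) (r # rs) acc ! j)
    = (\<Sum>k<length as. val (as ! k) * val (rs ! k ! j)) + (val a * val (r ! j) + val (acc ! j))"
    if "j < n" for j
    using 1 that by (cases a) (simp_all add: vadd_nth val_dadd algebra_simps)
  moreover have "length (combine (a # as) (r # rs) acc) = n"
    using 1 by (cases a) simp_all
  ultimately show ?case
    by (simp add: sum.lessThan_Suc_shift algebra_simps del: sum.lessThan_Suc combine.simps)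
qed auto

definition word :: "digit list \<Rightarrow> Z4 ^ 24" where
  "word w = (\<chi> i. val (w ! pos i))"

lemma word_nth [simp]: "word w $ i = val (w ! pos i)"
  by (simp add: word_def)

definition supp :: "bool list \<Rightarrow> 24 set" where
  "supp b = {i. b ! pos i}"

lemma odd_supp_word: "length w = 24 \<Longrightarrow> odd_supp (word w) = supp (map odd_digit w)"
  using pos_less by (simp add: odd_supp_def supp_def odd_digit_iff)

lemma card_odd_supp_word: "length w = 24 \<Longrightarrow> card (odd_supp (word w)) = count_odd w"
  by (simp add: odd_supp_def count_odd_def length_filter_conv_card odd_digit_iff
      card_pos[of "\<lambda>k. 2 * val (w ! k) \<noteq> 0"])

lemma card_two_supp_word: "length w = 24 \<Longrightarrow> card (two_supp (word w)) = count_two w"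
  by (simp add: two_supp_def count_two_def length_filter_conv_card T_iff
      card_pos[of "\<lambda>k. val (w ! k) = 2"])

lemma inj_on_supp: "inj_on supp {b. length b = 24}"
proof (rule inj_onI)
  fix b c assume *: "b \<in> {b. length b = 24}" "c \<in> {b. length b = 24}" "supp b = supp c"
  then have "b ! k \<longleftrightarrow> c ! k" if "k < 24" for k
    using that unfolding supp_def set_eq_iff mem_Collect_eq by (metis pos_pt)
  then show "b = c" using * by (intro nth_equalityI) simp_all
qed

lemma card_supp_inter:
  assumes "length b = 24" "length c = 24"
  shows "card (supp b \<inter> supp c) = inter b c"
proof -
  have "supp b \<inter> supp c = {i. b ! pos i \<and> c ! pos i}"
    by (auto simp: supp_def)
  then show ?thesis
    using assms by (simp add: inter_def length_filter_conv_card card_pos[of "\<lambda>k. b ! k \<and> c ! k"] cong: conj_cong)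
qed

lemma scalar_product_word:
  assumes "length x = 24" "length y = 24"
  shows "scalar_product (word x) (word y) = val (dot x y)"
  using assms by (simp add: val_dot scalar_product_def sum_pos[of "\<lambda>k. val (x ! k) * val (y ! k)"])

lemma euclid8_word:
  assumes "length w = 24" "8 dvd count_odd w + 4 * count_two w"
  shows "euclid8 (word w) = 0"
  using assms by (simp only: euclid8_eq card_odd_supp_word card_two_supp_word of_nat_8_eq_0_iff)

lemma matrix_length: "length matrix = 12" and row_length: "k < 12 \<Longrightarrow> length (matrix ! k) = 12"
  using matrix_shape by (auto simp: list_all_length)

lemma length_codeword: "length a = 12 \<Longrightarrow> length (codeword a) = 24"
  using combine_correct[of a matrix 12 "replicate 12 Z"] matrix_shape
  by (simp add: codeword_def)

text \<open>Encoding by the generator matrix (1 | A). The message is a function on all naturals that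
  is read only below 12, which spares a second vector type.\<close>

definition lin :: "(nat \<Rightarrow> Z4) \<Rightarrow> Z4 ^ 24" where
  "lin v = (\<chi> i. if pos i < 12 then v (pos i) else (\<Sum>k<12. v k * val (matrix ! k ! (pos i - 12))))"

lemma lin_nth: "lin v $ i = (if pos i < 12 then v (pos i) else (\<Sum>k<12. v k * val (matrix ! k ! (pos i - 12))))"
  by (simp add: lin_def)

lemma word_codeword:
  assumes "length a = 12"
  shows "word (codeword a) = lin (\<lambda>k. val (a ! k))"
proof -
  have "val (combine a matrix (replicate 12 Z) ! (pos i - 12))
      = (\<Sum>k<12. val (a ! k) * val (matrix ! k ! (pos i - 12)))" if "\<not> pos i < 12" for i
    using combine_correct[of a matrix 12 "replicate 12 Z"] matrix_shape assms pos_less[of i] that by simp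
  then show ?thesis
    using assms by (simp add: vec_eq_iff lin_nth codeword_def nth_append)
qed

definition Z4_golay :: "(Z4 ^ 24) set" where
  "Z4_golay = range lin"

lemma lin_add: "lin v + lin w = lin (\<lambda>k. v k + w k)"
  by (simp add: vec_eq_iff lin_nth sum.distrib algebra_simps)

lemma lin_scale: "c *s lin v = lin (\<lambda>k. c * v k)"
  by (simp add: vec_eq_iff lin_nth sum_distrib_left algebra_simps)

lemma lin_cong: "(\<And>k. k < 12 \<Longrightarrow> v k = w k) \<Longrightarrow> lin v = lin w"
  by (simp add: vec_eq_iff lin_nth)

lemma Z4_code_Z4_golay: "Z4_code Z4_golay"
proof -
  have "lin (\<lambda>_. 0) = 0" by (simp add: vec_eq_iff lin_nth)
  then show ?thesis
    unfolding Z4_code_iff Z4_golay_def by (auto simp: lin_add lin_scale intro: range_eqI[OF sym])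
qed

section \<open>Self-duality, Euclidean weights and residue weights of the lifted code\<close>

definition gen1 :: "nat \<Rightarrow> Z4 ^ 24" where
  "gen1 k = word (basis1 ! k)"

definition gen2 :: "nat \<Rightarrow> Z4 ^ 24" where
  "gen2 k = word (basis2 ! k)"

lemma length_unit [simp]: "length (unit k) = 12"
  by (simp add: unit_def)

lemma val_unit: "k < 12 \<Longrightarrow> j < 12 \<Longrightarrow> val (unit k ! j) = of_bool (j = k)"
  by (simp add: unit_def nth_list_update)

lemma length_basis: "length basis1 = 12" "length basis2 = 12"
  "k < 12 \<Longrightarrow> length (basis1 ! k) = 24" "k < 12 \<Longrightarrow> length (basis2 ! k) = 24"
  by (simp_all add: basis1_def basis2_def length_codeword matrix_length row_length)

lemma gen1_lin: "k < 12 \<Longrightarrow> gen1 k = lin (\<lambda>j. of_bool (j = k))"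
  by (simp add: gen1_def basis1_def word_codeword val_unit cong: lin_cong)

lemma gen1_in: "k < 12 \<Longrightarrow> gen1 k \<in> Z4_golay"
  by (simp add: gen1_lin Z4_golay_def)

lemma gen2_in: "k < 12 \<Longrightarrow> gen2 k \<in> Z4_golay"
  by (simp add: gen2_def basis2_def matrix_length word_codeword row_length Z4_golay_def)

lemma sum_of_bool_eq_mult:
  fixes k n :: nat
  assumes "k < n"
  shows "(\<Sum>l<n. of_bool (l = k) * f l) = (f k :: Z4)"
proof -
  have "(\<Sum>l<n. of_bool (l = k) * f l) = (\<Sum>l<n. if l = k then f l else 0)"
    by (intro sum.cong) simp_all
  also have "\<dots> = f k"
    using assms by (subst sum.delta) simp_all
  finally show ?thesis .
qed

lemma lin_gen1: "lin v = (\<Sum>k<12. v k *s gen1 k)"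
proof -
  have "(\<Sum>k<12. v k *s gen1 k) $ i = lin v $ i" for i
  proof -
    have "(\<Sum>k<12. v k *s gen1 k) $ i = (\<Sum>k<12. v k * lin (\<lambda>j. of_bool (j = k)) $ i)"
      by (simp add: gen1_lin)
    also have "\<dots> = lin v $ i"
    proof (cases "pos i < 12")
      case True
      then have "(\<Sum>k<12. v k * lin (\<lambda>j. of_bool (j = k)) $ i) = (\<Sum>k<12. of_bool (k = pos i) * v k)"
        by (intro sum.cong) (auto simp: lin_nth)
      then show ?thesis using sum_of_bool_eq_mult[OF True, of v] True by (simp only: lin_nth if_True)
    next
      case False
      then have "(\<Sum>k<12. v k * lin (\<lambda>j. of_bool (j = k)) $ i)
          = (\<Sum>k<12. v k * val (matrix ! k ! (pos i - 12)))"
        by (intro sum.cong) (simp_all add: lin_nth sum_of_bool_eq_mult)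
      then show ?thesis using False by (simp only: lin_nth if_False)
    qed
    finally show ?thesis .
  qed
  then show ?thesis by (simp add: vec_eq_iff)
qed

lemma scalar_product_sum_left:
  "scalar_product (\<Sum>k\<in>A. f k) y = (\<Sum>k\<in>A. scalar_product (f k) (y :: Z4 ^ 'n))"
  by (induction A rule: infinite_finite_induct) (simp_all add: scalar_product_add_left)

lemma scalar_product_single:
  assumes "\<And>j. j \<noteq> i \<Longrightarrow> x $ j * y $ j = 0" "y $ i = 1"
  shows "scalar_product x y = (x $ i :: Z4)"
proof -
  have "scalar_product x y = x $ i * y $ i + (\<Sum>j\<in>UNIV - {i}. x $ j * y $ j)"
    unfolding scalar_product_def by (rule sum.remove) simp_all
  also have "(\<Sum>j\<in>UNIV - {i}. x $ j * y $ j) = 0"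
    using assms(1) by (intro sum.neutral) blast
  finally show ?thesis by (simp add: assms(2))
qed

lemma gen1_orthogonal:
  assumes "k < 12" "l < 12"
  shows "scalar_product (gen1 k) (gen1 l) = 0"
proof -
  have "dot (basis1 ! k) (basis1 ! l) = Z"
    using basis1_orthogonal assms by (simp add: list_all_length length_basis)
  then show ?thesis
    using assms by (simp add: gen1_def scalar_product_word length_basis)
qed

lemma Z4_golay_orthogonal:
  assumes "x \<in> Z4_golay" "y \<in> Z4_golay"
  shows "scalar_product x y = 0"
proof -
  have *: "scalar_product (lin v) y = 0" if "\<And>k. k < 12 \<Longrightarrow> scalar_product (gen1 k) y = 0" for v y
    unfolding lin_gen1 scalar_product_sum_left scalar_product_scale_left
    using that by (intro sum.neutral) simp
  obtain v w where vw: "x = lin v" "y = lin w" using assms by (auto simp: Z4_golay_def)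
  have "scalar_product (lin w) (gen1 k) = 0" if "k < 12" for k
    using that gen1_orthogonal by (intro *)
  then show ?thesis
    unfolding vw by (intro *) (simp add: scalar_product_commute[of _ "lin w"])
qed

lemma gen1_nth: "k < 12 \<Longrightarrow> pos i < 12 \<Longrightarrow> gen1 k $ i = of_bool (pos i = k)"
  by (simp add: gen1_lin lin_nth)

lemma gen2_nth:
  assumes "k < 12" "\<not> pos i < 12"
  shows "gen2 k $ i = of_bool (pos i = 12 + k)"
proof -
  have "map (drop 12) basis2 ! k = map unit [0..<12] ! k"
    by (simp only: basis2_systematic)
  then have "drop 12 (basis2 ! k) = unit k"
    using assms(1) by (simp add: length_basis)
  then have "drop 12 (basis2 ! k) ! (pos i - 12) = unit k ! (pos i - 12)"
    by simp
  moreover have "pos i - 12 < 12" using pos_less[of i] by linarith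
  ultimately have "val (basis2 ! k ! pos i) = of_bool (pos i - 12 = k)"
    using assms val_unit[of k "pos i - 12"] by (simp add: length_basis)
  moreover have "pos i - 12 = k \<longleftrightarrow> pos i = 12 + k" using assms(2) by linarith
  ultimately show ?thesis by (simp add: gen2_def)
qed

text \<open>On the last half the vectors \<open>gen2\<close> are unit vectors, so for a word that
  vanishes on the first half the inner products with them are its remaining entries.\<close>

lemma dual_zero_if_first_zero:
  assumes "x \<in> dual_code Z4_golay" "\<And>i. pos i < 12 \<Longrightarrow> x $ i = 0"
  shows "x = 0"
proof -
  have "x $ i = 0" if i: "\<not> pos i < 12" for i
  proof -
    have k: "pos i - 12 < 12" using pos_less[of i] by linarith
    have "scalar_product x (gen2 (pos i - 12)) = x $ i"
    proof (rule scalar_product_single)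
      fix j assume "j \<noteq> i"
      then have "pos j \<noteq> pos i" by (metis pt_pos)
      then show "x $ j * gen2 (pos i - 12) $ j = 0"
        using assms(2)[of j] gen2_nth[OF k, of j] i by (cases "pos j < 12") simp_all
    qed (use gen2_nth[OF k i] i in simp)
    then show ?thesis using assms(1) gen2_in[OF k] by (simp add: dual_code_def)
  qed
  then show ?thesis using assms(2) by (simp add: vec_eq_iff) metis
qed

lemma dual_zero_if_last_zero:
  assumes "x \<in> dual_code Z4_golay" "\<And>i. \<not> pos i < 12 \<Longrightarrow> x $ i = 0"
  shows "x = 0"
proof -
  have "x $ i = 0" if i: "pos i < 12" for i
  proof -
    have "scalar_product x (gen1 (pos i)) = x $ i"
    proof (rule scalar_product_single)
      fix j assume "j \<noteq> i"
      then have "pos j \<noteq> pos i" by (metis pt_pos)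
      then show "x $ j * gen1 (pos i) $ j = 0"
        using assms(2)[of j] gen1_nth[OF i, of j] by (cases "pos j < 12") simp_all
    qed (simp add: gen1_nth i)
    then show ?thesis using assms(1) gen1_in[OF i] by (simp add: dual_code_def)
  qed
  then show ?thesis using assms(2) by (simp add: vec_eq_iff) metis
qed

lemma diff_in_dual: "x \<in> dual_code C \<Longrightarrow> y \<in> dual_code C \<Longrightarrow> x - y \<in> dual_code C"
  by (simp add: dual_code_def scalar_product_def left_diff_distrib sum_subtractf)

text \<open>Subtracting the codeword with the same first half from a dual word leaves a dual word
  that vanishes there, hence zero.\<close>

lemma dual_Z4_golay: "dual_code Z4_golay = Z4_golay"
proof
  show sub: "Z4_golay \<subseteq> dual_code Z4_golay"
    using Z4_golay_orthogonal by (auto simp: dual_code_def)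
  show "dual_code Z4_golay \<subseteq> Z4_golay"
  proof
    fix x assume x: "x \<in> dual_code Z4_golay"
    let ?y = "lin (\<lambda>k. x $ pt k)"
    have y: "?y \<in> Z4_golay" by (simp add: Z4_golay_def)
    have "x - ?y = 0"
    proof (rule dual_zero_if_first_zero)
      show "x - ?y \<in> dual_code Z4_golay"
        using x y sub by (intro diff_in_dual) auto
    qed (simp add: lin_nth)
    then show "x \<in> Z4_golay" using y by simp
  qed
qed

lemma self_dual_Z4_golay: "self_dual Z4_golay"
  by (simp add: self_dual_def dual_Z4_golay)

lemma sum_in_Z4_golay:
  "(\<And>k. k \<in> A \<Longrightarrow> f k \<in> Z4_golay) \<Longrightarrow> sum f A \<in> Z4_golay"
  using Z4_code_Z4_golay
  by (induction A rule: infinite_finite_induct) (auto simp: Z4_code_iff)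

lemma scale_in_Z4_golay: "x \<in> Z4_golay \<Longrightarrow> c *s x \<in> Z4_golay"
  using Z4_code_Z4_golay by (simp add: Z4_code_iff)

text \<open>The cross terms vanish by orthogonality and scalars act through their squares, so the
  twelve generators decide.\<close>

lemma Z4_golay_euclid8:
  assumes "x \<in> Z4_golay"
  shows "euclid8 x = 0"
proof -
  have gen: "euclid8 (c *s gen1 k) = 0" if "k < 12" for c k
    using basis1_euclid that
    by (simp add: euclid8_scale gen1_def euclid8_word list_all_length length_basis)
  have in_code: "c *s gen1 k \<in> Z4_golay" if "k < 12" for c k
    using that gen1_in scale_in_Z4_golay by blast
  have "euclid8 (\<Sum>k\<in>A. v k *s gen1 k) = 0" if "A \<subseteq> {..<12}" for A v
    using finite_subset[OF that finite_lessThan] that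
  proof (induction A rule: finite_induct)
    case (insert k A)
    have "scalar_product (v k *s gen1 k) (\<Sum>k\<in>A. v k *s gen1 k) = 0"
      using insert.prems by (intro Z4_golay_orthogonal sum_in_Z4_golay in_code) auto
    then show ?case
      using insert by (simp add: euclid8_add gen dbl8_def)
  qed (simp add: euclid8_def sq8_def)
  moreover obtain v where "x = lin v" using assms by (auto simp: Z4_golay_def)
  ultimately show ?thesis by (simp add: lin_gen1)
qed

text \<open>The first half of a codeword is its message, so an even codeword has an even message,
  which is halved entry by entry.\<close>

lemma Z4_golay_halvable:
  assumes "x \<in> Z4_golay" "odd_supp x = {}"
  shows "\<exists>y\<in>Z4_golay. x = 2 *s y"
proof -
  obtain v where v: "x = lin v" using assms by (auto simp: Z4_golay_def)
  have "v k = 2 * of_bool (v k = 2)" if "k < 12" for k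
  proof -
    have "pt k \<notin> odd_supp x" using assms(2) by blast
    then have "2 * v k = 0" using that by (simp add: odd_supp_def v lin_nth)
    then show ?thesis by (cases "v k" rule: Z4_cases) simp_all
  qed
  then have "x = 2 *s lin (\<lambda>k. of_bool (v k = 2))"
    unfolding v lin_scale by (rule lin_cong)
  then show ?thesis unfolding Z4_golay_def by blast
qed

lemma word_vadd: "length x = 24 \<Longrightarrow> length y = 24 \<Longrightarrow> word (vadd x y) = word x + word y"
  using pos_less by (simp add: vec_eq_iff vadd_nth val_dadd)

text \<open>The positions \<open>p j\<close> form an information set for \<open>bs\<close>: the
  entries of \<open>x\<close> there are its coefficients. Stated for arbitrary \<open>p\<close> and
  \<open>bs\<close>, the argument covers both halves.\<close>

lemma card_odd_supp_neq_4:
  assumes x: "x = (\<Sum>j<12. x $ p j *s word (bs ! j))"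
    and bs: "length bs = 12" "\<And>j. j < 12 \<Longrightarrow> length (bs ! j) = 24" "no_weight_4 bs"
    and K: "card {j. j < 12 \<and> p j \<in> odd_supp x} \<le> 2" and nonempty: "odd_supp x \<noteq> {}"
  shows "card (odd_supp x) \<noteq> 4"
proof -
  define K where "K = {j. j < 12 \<and> p j \<in> odd_supp x}"
  have fin: "finite K" unfolding K_def by simp
  \<comment> \<open>Equality of doubles is equality modulo 2, where only the parity of a coefficient
    matters.\<close>
  have "2 *s x = 2 *s (\<Sum>j\<in>K. word (bs ! j))"
  proof -
    have dbl: "2 * a = (if 2 * a \<noteq> 0 then 2 else 0)" for a :: Z4
      by (cases a rule: Z4_cases) simp_all
    have "(2 *s x) $ i = (2 *s (\<Sum>j\<in>K. word (bs ! j))) $ i" for i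
    proof -
      have "(2 *s x) $ i = (\<Sum>j<12. (2 * x $ p j) * word (bs ! j) $ i)"
        by (subst x) (simp add: sum_distrib_left mult.assoc)
      also have "\<dots> = (\<Sum>j<12. if p j \<in> odd_supp x then 2 * word (bs ! j) $ i else 0)"
        unfolding odd_supp_def mem_Collect_eq by (intro sum.cong refl) (subst dbl, simp)
      also have "\<dots> = (\<Sum>j\<in>K. 2 * word (bs ! j) $ i)"
        by (simp add: sum.If_cases K_def lessThan_def Int_def)
      finally show ?thesis by (simp add: sum_distrib_left)
    qed
    then show ?thesis by (simp add: vec_eq_iff)
  qed
  then have supp: "odd_supp x = odd_supp (\<Sum>j\<in>K. word (bs ! j))"
    by (metis two_supp_double)
  have "card K = 0 \<or> card K = 1 \<or> card K = 2" using K unfolding K_def by linarith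
  then consider "K = {}" | j where "K = {j}" | j l where "K = {j, l}" "j \<noteq> l"
    using fin by (metis card_0_eq card_1_singletonE card_2_iff)
  then show ?thesis
  proof cases
    case 1
    then show ?thesis using supp nonempty by simp
  next
    case (2 j)
    then have "j < 12" unfolding K_def by blast
    then have "card (odd_supp x) = count_odd (bs ! j)"
      using bs(2) by (simp add: supp 2 card_odd_supp_word)
    then show ?thesis
      using bs(1,3) \<open>j < 12\<close> by (simp add: no_weight_4_def list_all_length)
  next
    case (3 j l)
    then have "j < 12" "l < 12" unfolding K_def by blast+
    then have "card (odd_supp x) = count_odd (vadd (bs ! j) (bs ! l))"
      using bs(2) 3 by (simp add: supp card_odd_supp_word flip: word_vadd)
    then show ?thesis
      using bs(1,3) \<open>j < 12\<close> \<open>l < 12\<close> by (simp add: no_weight_4_def list_all_length)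
  qed
qed

lemma card_halves:
  "card A = card {j. j < 12 \<and> pt j \<in> A} + card {j. j < 12 \<and> pt (12 + j) \<in> A}"
proof -
  have "card A = card {i. pt (pos i) \<in> A}" by simp
  also have "\<dots> = card {k. k < 24 \<and> pt k \<in> A}" by (rule card_pos)
  also have "{k. k < 24 \<and> pt k \<in> A} = {j. j < 12 \<and> pt j \<in> A} \<union> (+) 12 ` {j. j < 12 \<and> pt (12 + j) \<in> A}"
  proof -
    have "k \<in> (+) 12 ` {j. j < 12 \<and> pt (12 + j) \<in> A}" if "k < 24" "\<not> k < 12" "pt k \<in> A" for k
      using that by (intro image_eqI[of _ _ "k - 12"]) simp_all
    then show ?thesis by auto
  qed
  also have "card \<dots> = card {j. j < 12 \<and> pt j \<in> A} + card ((+) 12 ` {j. j < 12 \<and> pt (12 + j) \<in> A})"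
    by (rule card_Un_disjoint) auto
  also have "card ((+) 12 ` {j. j < 12 \<and> pt (12 + j) \<in> A}) = card {j. j < 12 \<and> pt (12 + j) \<in> A}"
    by (rule card_image) simp
  finally show ?thesis .
qed

text \<open>Divisibility of the Euclidean weight makes the number of odd entries a multiple of 4, so
  only the value 4 has to be excluded; then some half has at most two odd entries.\<close>

lemma Z4_golay_residue_weight:
  assumes "x \<in> Z4_golay" "odd_supp x \<noteq> {}"
  shows "8 \<le> card (odd_supp x)"
proof -
  obtain v where v: "x = lin v" using assms by (auto simp: Z4_golay_def)
  have exp1: "x = (\<Sum>j<12. x $ pt j *s gen1 j)"
  proof -
    have "x = lin (\<lambda>k. x $ pt k)" unfolding v by (rule lin_cong) (simp add: lin_nth)
    then show ?thesis by (simp only: lin_gen1)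
  qed
  have exp2: "x = (\<Sum>j<12. x $ pt (12 + j) *s gen2 j)"
  proof -
    let ?y = "\<Sum>j<12. x $ pt (12 + j) *s gen2 j"
    have "x - ?y = 0"
    proof (rule dual_zero_if_last_zero)
      have "?y \<in> Z4_golay"
        by (intro sum_in_Z4_golay scale_in_Z4_golay gen2_in) simp
      then show "x - ?y \<in> dual_code Z4_golay"
        using assms(1) by (intro diff_in_dual) (simp_all add: dual_Z4_golay)
      fix i assume i: "\<not> pos i < 12"
      then have k: "pos i - 12 < 12" "12 + (pos i - 12) = pos i" using pos_less[of i] by linarith+
      have "(\<Sum>j<12. x $ pt (12 + j) * gen2 j $ i) = (\<Sum>j<12. of_bool (j = pos i - 12) * x $ pt (12 + j))"
        using i by (intro sum.cong) (auto simp: gen2_nth)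
      also have "\<dots> = x $ pt (12 + (pos i - 12))"
        using k(1) by (rule sum_of_bool_eq_mult)
      finally show "(x - ?y) $ i = 0" unfolding k(2) by simp
    qed
    then show ?thesis by simp
  qed
  have "card (odd_supp x) \<noteq> 4"
  proof
    assume 4: "card (odd_supp x) = 4"
    then consider "card {j. j < 12 \<and> pt j \<in> odd_supp x} \<le> 2" | "card {j. j < 12 \<and> pt (12 + j) \<in> odd_supp x} \<le> 2"
      using card_halves[of "odd_supp x"] by linarith
    then show False
    proof cases
      case 1
      then show ?thesis
        using card_odd_supp_neq_4[of x pt basis1] exp1[unfolded gen1_def] length_basis basis1_weight assms(2) 4
        by blast
    next
      case 2
      then show ?thesis
        using card_odd_supp_neq_4[of x "\<lambda>j. pt (12 + j)" basis2] exp2[unfolded gen2_def] length_basis basis2_weight assms(2) 4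
        by blast
    qed
  qed
  moreover have "8 dvd card (odd_supp x) + 4 * card (two_supp x)"
    using Z4_golay_euclid8[OF assms(1)] by (simp only: euclid8_eq of_nat_8_eq_0_iff)
  moreover have "card (odd_supp x) \<noteq> 0" using assms(2) by simp
  ultimately show ?thesis by presburger
qed

interpretation golay: residue_code Z4_golay
  by unfold_locales (fact Z4_code_Z4_golay self_dual_Z4_golay Z4_golay_euclid8
      Z4_golay_halvable Z4_golay_residue_weight)+

section \<open>Completeness of the list of octads\<close>

lemma codeword_in_Z4_golay: "length a = 12 \<Longrightarrow> word (codeword a) \<in> Z4_golay"
  by (simp add: word_codeword Z4_golay_def)

text \<open>Coordinate 0 plays the role of \<open>z\<close>, so the lists belong to the coordinates
  from 1 on; hence the shift of the index.\<close>

definition partner_parities :: "nat \<Rightarrow> bool list list" where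
  "partner_parities q = parities (partner_words ! (q - 1))"

lemma length_partner_words: "length partner_words = 23"
  using arg_cong[OF pair_counts, of length] by (simp add: weights_def)

lemma partner_words_nth:
  assumes "q \<in> {1..<24}"
  shows "length (partner_words ! (q - 1)) = 22"
    and "a \<in> set (partner_words ! (q - 1)) \<Longrightarrow> good_word q a"
    and "distinct (partner_parities q)"
proof -
  have len: "q - 1 < length partner_words" using assms by (auto simp: length_partner_words)
  then have nth: "List.enumerate 1 partner_words ! (q - 1) = (q, partner_words ! (q - 1))"
    using assms by (simp add: nth_enumerate_eq)
  then have *: "length (partner_words ! (q - 1)) = 22 \<and> list_all (good_word q) (partner_words ! (q - 1))"
    using partner_words_good[unfolded list_all_length length_enumerate, rule_format, OF len]
    unfolding nth by (simp add: list_all_length)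
  show "length (partner_words ! (q - 1)) = 22" using * by blast
  show "a \<in> set (partner_words ! (q - 1)) \<Longrightarrow> good_word q a" using * by (auto simp: list_all_iff)
  show "distinct (partner_parities q)"
    using partner_words_increasing len distinct_if_successively_lex_less
    by (auto simp: partner_parities_def list_all_length)
qed

lemma supp_parity: "length a = 12 \<Longrightarrow> supp (map odd_digit (codeword a)) = odd_supp (word (codeword a))"
  by (simp add: odd_supp_word length_codeword)

lemma length_group: "q \<in> {1..<24} \<Longrightarrow> b \<in> set (partner_parities q) \<Longrightarrow> length b = 24"
  using partner_words_nth(2) by (auto simp: partner_parities_def parities_def good_word_def length_codeword)

lemma inj_on_supp_group: "q \<in> {1..<24} \<Longrightarrow> inj_on supp (set (partner_parities q))"
  using inj_on_supp by (rule inj_on_subset) (auto simp: length_group)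

lemma group_partners:
  assumes "q \<in> {1..<24}"
  shows "supp ` set (partner_parities q) \<subseteq> golay.partners (pt 0) (pt q)"
proof
  fix b assume "b \<in> supp ` set (partner_parities q)"
  then obtain a where a: "a \<in> set (partner_words ! (q - 1))" "b = supp (map odd_digit (codeword a))"
    by (auto simp: partner_parities_def parities_def)
  let ?x = "word (codeword a)"
  have g: "length a = 12" "count_odd (codeword a) = 8" "count_two (codeword a) = 2"
    "codeword a ! 0 = T" "codeword a ! q = T"
    using partner_words_nth(2)[OF assms a(1)] by (simp_all add: good_word_def Let_def)
  have "pt 0 \<noteq> pt q" using assms pos_pt[of 0] pos_pt[of q] by fastforce
  moreover have "{pt 0, pt q} \<subseteq> two_supp ?x"
    using g assms by (simp add: mem_two_supp)
  moreover have "card (two_supp ?x) = 2"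
    using g by (simp add: card_two_supp_word length_codeword)
  ultimately have "two_supp ?x = {pt 0, pt q}"
    by (intro card_seteq[symmetric]) simp_all
  moreover have "card (odd_supp ?x) = 8"
    using g by (simp add: card_odd_supp_word length_codeword)
  ultimately show "b \<in> golay.partners (pt 0) (pt q)"
    unfolding golay.partners_def mem_Collect_eq a(2) supp_parity[OF g(1)]
    using codeword_in_Z4_golay[OF g(1)] by blast
qed

definition base_octads :: "24 set set" where
  "base_octads = supp ` set (parities base_words)"

lemma base_octads:
  assumes "b \<in> base_octads"
  shows "pt 0 \<in> b" "\<exists>x\<in>Z4_golay. odd_supp x = b \<and> card b = 8 \<and> card (two_supp x) = 2"
proof -
  obtain a where a: "a \<in> set base_words" "b = supp (map odd_digit (codeword a))"
    using assms by (auto simp: base_octads_def parities_def)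
  have g: "length a = 12" "count_odd (codeword a) = 8" "count_two (codeword a) = 2"
    "odd_digit (codeword a ! 0)"
    using base_words_good a(1) by (auto simp: list_all_iff good_base_word_def Let_def)
  have b: "b = odd_supp (word (codeword a))" using a(2) supp_parity[OF g(1)] by simp
  show "pt 0 \<in> b" using g(1,4) by (simp add: a(2) supp_def length_codeword)
  show "\<exists>x\<in>Z4_golay. odd_supp x = b \<and> card b = 8 \<and> card (two_supp x) = 2"
    using codeword_in_Z4_golay[OF g(1)] g
    by (intro bexI[of _ "word (codeword a)"]) (simp_all add: b card_odd_supp_word card_two_supp_word length_codeword)
qed

lemma card_base_octads: "card base_octads = 253"
proof -
  have "inj_on supp (set (parities base_words))"
    using inj_on_supp base_words_good
    by (rule_tac inj_on_subset) (auto simp: parities_def list_all_iff good_base_word_def length_codeword)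
  then have "card base_octads = card (set (parities base_words))"
    unfolding base_octads_def by (rule card_image)
  also have "\<dots> = length (parities base_words)"
    using distinct_if_successively_lex_less[OF base_words_increasing] by (rule distinct_card)
  finally show ?thesis using base_words_good by (simp add: parities_def)
qed

lemma pt_inj: "i < 24 \<Longrightarrow> j < 24 \<Longrightarrow> pt i = pt j \<Longrightarrow> i = j"
  by (metis pos_pt)

text \<open>Different lists are disjoint by \<open>partners_disjoint\<close>, and the base octads
  are the ones through \<open>pt 0\<close>, so distinctness is computed only within a list. The
  total 23 * 22 + 253 reaches the packing bound, which makes the enumeration complete.\<close>

lemma octads_eq:
  "golay.octads = (\<Union>q\<in>{1..<24}. supp ` set (partner_parities q)) \<union> base_octads"
  and card_octads: "card golay.octads = 759"
proof -
  let ?S = "\<lambda>q. supp ` set (partner_parities q)"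
  have "card (?S q) = 22" if "q \<in> {1..<24}" for q
    using card_image[OF inj_on_supp_group[OF that]] distinct_card[OF partner_words_nth(3)[OF that]]
      partner_words_nth(1)[OF that] by (simp add: partner_parities_def parities_def)
  moreover have "?S p \<inter> ?S q = {}" if pq: "p \<in> {1..<24}" "q \<in> {1..<24}" "p \<noteq> q" for p q
  proof (rule ccontr)
    assume "?S p \<inter> ?S q \<noteq> {}"
    then obtain a where "a \<in> golay.partners (pt 0) (pt p)" "a \<in> golay.partners (pt 0) (pt q)"
      using group_partners[OF pq(1)] group_partners[OF pq(2)] by blast
    then have "pt p = pt q"
      using pq pt_inj[of p 0] pt_inj[of q 0] by (intro golay.partners_disjoint) auto
    then show False using pt_inj[of p q] pq by simp
  qed
  ultimately have "card (\<Union>q\<in>{1..<24}. ?S q) = 23 * 22"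
    by (subst card_UN_disjoint) simp_all
  moreover have "(\<Union>q\<in>{1..<24}. ?S q) \<inter> base_octads = {}"
    using group_partners golay.partners_not_mem base_octads(1) by blast
  ultimately have card: "card ((\<Union>q\<in>{1..<24}. ?S q) \<union> base_octads) = 759"
    by (subst card_Un_disjoint) (simp_all add: card_base_octads)
  have "base_octads \<subseteq> golay.octads"
    using base_octads(2) unfolding golay.octads_def by blast
  then have sub: "(\<Union>q\<in>{1..<24}. ?S q) \<union> base_octads \<subseteq> golay.octads"
    using group_partners golay.partners_octads by blast
  show eq: "golay.octads = (\<Union>q\<in>{1..<24}. ?S q) \<union> base_octads"
    using sub golay.card_octads_le card by (intro card_seteq[symmetric]) simp_all
  show "card golay.octads = 759" using card by (simp only: eq)
qed

text \<open>By completeness a partner octad of \<open>q\<close> occurs in some list, and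
  disjointness of partners leaves only the list of \<open>q\<close>.\<close>

lemma partners_eq:
  assumes "q \<in> {1..<24}"
  shows "golay.partners (pt 0) (pt q) = supp ` set (partner_parities q)"
proof
  show "golay.partners (pt 0) (pt q) \<subseteq> supp ` set (partner_parities q)"
  proof
    fix a assume a: "a \<in> golay.partners (pt 0) (pt q)"
    then have "a \<notin> base_octads" using golay.partners_not_mem base_octads(1) by blast
    then obtain p where p: "p \<in> {1..<24}" "a \<in> supp ` set (partner_parities p)"
      using a golay.partners_octads octads_eq by blast
    then have "a \<in> golay.partners (pt 0) (pt p)" using group_partners by blast
    then have "pt p = pt q"
      using a p(1) assms pt_inj[of p 0] pt_inj[of q 0] by (intro golay.partners_disjoint) auto
    then have "p = q" using pt_inj[of p q] p(1) assms by simp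
    then show "a \<in> supp ` set (partner_parities q)" using p(2) by blast
  qed
qed (rule group_partners[OF assms])

section \<open>Evaluation of the invariants and rigidity\<close>

lemma sum_group:
  assumes "q \<in> {1..<24}"
  shows "(\<Sum>a\<in>golay.partners (pt 0) (pt q). f a) = sum_list (map (\<lambda>b. f (supp b)) (partner_parities q))"
  unfolding partners_eq[OF assms] sum.reindex[OF inj_on_supp_group[OF assms]]
  using partner_words_nth(3)[OF assms] by (simp add: sum_list_distinct_conv_sum_set)

lemma weight_pt:
  assumes "q \<in> {1..<24}"
  shows "golay.weight (pt 0) (pt q) = weights ! q"
proof -
  have "card {b \<in> golay.partners (pt 0) (pt q). card (supp x \<inter> b) = 4} = length (filter (\<lambda>y. inter x y = 4) (partner_parities q))"
    if x: "x \<in> set (partner_parities q)" for x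
  proof -
    have "{b \<in> golay.partners (pt 0) (pt q). card (supp x \<inter> b) = 4} = supp ` {y \<in> set (partner_parities q). inter x y = 4}"
      unfolding partners_eq[OF assms] using x length_group[OF assms] by (auto simp: card_supp_inter)
    moreover have "inj_on supp {y \<in> set (partner_parities q). inter x y = 4}"
      using inj_on_supp_group[OF assms] by (rule inj_on_subset) blast
    ultimately have "card {b \<in> golay.partners (pt 0) (pt q). card (supp x \<inter> b) = 4} = card {y \<in> set (partner_parities q). inter x y = 4}"
      by (simp add: card_image)
    also have "{y \<in> set (partner_parities q). inter x y = 4} = set (filter (\<lambda>y. inter x y = 4) (partner_parities q))" by auto
    also have "card \<dots> = length (filter (\<lambda>y. inter x y = 4) (partner_parities q))"
      using partner_words_nth(3)[OF assms] by (intro distinct_card distinct_filter)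
    finally show ?thesis .
  qed
  then have "golay.weight (pt 0) (pt q) = int (pair_count (partner_parities q))"
    unfolding golay.weight_def sum_group[OF assms] pair_count_def
    by (simp add: sum_list_of_nat[symmetric] comp_def cong: map_cong)
  also have "\<dots> = map (\<lambda>g. int (pair_count (parities g))) partner_words ! (q - 1)"
    using assms by (auto simp: partner_parities_def length_partner_words)
  also have "\<dots> = tl weights ! (q - 1)" by (simp only: pair_counts)
  also have "\<dots> = weights ! q" using assms by (simp add: nth_tl weights_def)
  finally show ?thesis .
qed

lemma weight_sum_eq: "length b = length ts \<Longrightarrow> weight_sum ts b = (\<Sum>k<length ts. of_bool (b ! k) * ts ! k)"
proof (induction ts b rule: weight_sum.induct)
  case (1 t ts b bs)
  then show ?case by (simp add: sum.lessThan_Suc_shift del: sum.lessThan_Suc)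
qed simp_all

lemma weight_profile_pt:
  assumes "q \<in> {1..<24}"
  shows "golay.weight_profile (pt 0) (pt q) = profile (partner_parities q)"
proof -
  have "(\<Sum>i\<in>supp b. golay.weight (pt 0) i) = weight_sum weights b" if b: "b \<in> set (partner_parities q)" for b
  proof -
    have len: "length b = 24" using length_group[OF assms b] .
    have "pt 0 \<notin> supp b" using group_partners[OF assms] b golay.partners_not_mem by blast
    have "(\<Sum>i\<in>supp b. golay.weight (pt 0) i) = (\<Sum>i\<in>supp b. weights ! pos i)"
    proof (rule sum.cong)
      fix i assume "i \<in> supp b"
      \<comment> \<open>The octads of the lists avoid \<open>pt 0\<close>, so the dummy weight at
        index 0 never enters.\<close>
      then have "pos i \<noteq> 0" using \<open>pt 0 \<notin> supp b\<close> by (metis pt_pos)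
      then have "pos i \<in> {1..<24}" using pos_less[of i] by simp
      from weight_pt[OF this] show "golay.weight (pt 0) i = weights ! pos i" by simp
    qed simp
    also have "\<dots> = (\<Sum>i\<in>UNIV. of_bool (b ! pos i) * weights ! pos i)"
      by (rule sum.mono_neutral_cong_left) (auto simp: supp_def)
    also have "\<dots> = (\<Sum>k<24. of_bool (b ! k) * weights ! k)"
      by (rule sum_pos)
    also have "\<dots> = weight_sum weights b"
    proof -
      have "length weights = 24" by (simp add: weights_def)
      then show ?thesis using weight_sum_eq[of b weights] len by simp
    qed
    finally show ?thesis .
  qed
  then show ?thesis
    unfolding golay.weight_profile_def sum_group[OF assms] profile_def by (simp cong: map_cong)
qed

lemma inj_on_weight_profile: "inj_on (golay.weight_profile (pt 0)) (- {pt 0})"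
proof (rule inj_onI)
  fix i j assume ij: "i \<in> - {pt 0}" "j \<in> - {pt 0}"
    "golay.weight_profile (pt 0) i = golay.weight_profile (pt 0) j"
  let ?l = "map (\<lambda>g. profile (parities g)) partner_words"
  have pos: "pos i \<in> {1..<24}" if "i \<in> - {pt 0}" for i
    using that pos_less[of i] by (metis ComplD One_nat_def Suc_leI atLeastLessThan_iff neq0_conv pt_pos singletonI)
  have nth: "golay.weight_profile (pt 0) i = ?l ! (pos i - 1)" if "i \<in> - {pt 0}" for i
    using weight_profile_pt[OF pos[OF that]] pos[OF that] by (auto simp: partner_parities_def length_partner_words)
  have "pos i - 1 = pos j - 1"
    using profiles_distinct nth[OF ij(1)] nth[OF ij(2)] ij(3) pos[OF ij(1)] pos[OF ij(2)]
    by (subst nth_eq_iff_index_eq[OF profiles_distinct, symmetric]) (auto simp: length_partner_words)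
  then have "pos i = pos j" using pos[OF ij(1)] pos[OF ij(2)] by auto
  then show "i = j" by (metis pt_pos)
qed

interpretation golay: rigid_code Z4_golay "pt 0"
proof
  show "759 \<le> card golay.octads" by (simp add: card_octads)
  show "\<pi> = id" if "\<pi> \<in> golay.aut" "\<pi> (pt 0) = pt 0" for \<pi>
    using golay.rigid_if_inj_weight_profile[OF inj_on_weight_profile that] .
  fix a assume "a \<in> golay.octads"
  then consider q where "q \<in> {1..<24}" "a \<in> golay.partners (pt 0) (pt q)" | "a \<in> base_octads"
    using octads_eq group_partners by blast
  then show "\<exists>x\<in>Z4_golay. odd_supp x = a \<and> card (two_supp x) = 2 \<and> (pt 0 \<in> a \<or> pt 0 \<in> two_supp x)"
  proof cases
    case 1
    moreover have "pt 0 \<noteq> pt q" using pt_inj[of 0 q] 1(1) by auto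
    ultimately show ?thesis unfolding golay.partners_def by auto
  next
    case 2
    then show ?thesis using base_octads by blast
  qed
qed

theorem proposition4p4:
  shows "\<exists>S :: (Z4 ^ 24) set set.
    finite S \<and> card S \<ge> 60 \<and>
    (\<forall>C\<in>S. Z4_code C \<and> self_dual C \<and> min_lee_weight C = 10) \<and>
    pairwise (\<lambda>C D. \<not> equivalent_codes C D) S"
  using golay.twisted_classes by metis

end
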